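(* Let $\mathcal{C}_1, \ldots, \mathcal{C}_r$ be countable chains each with finite big Ramsey spectrum. For every choice of finite chains $n_1, \ldots, n_r$ (positive integers) there is a positive integer $N$ such that for every $k \ge 1$ and every coloring $$\gamma : \mathrm{Emb}(n_1, \mathcal{C}_1) \times \cdots \times \mathrm{Emb}(n_r, \mathcal{C}_r) \to \{0, 1, \ldots, k-1\}$$ there are embeddings $w_i : \mathcal{C}_i \hookrightarrow \mathcal{C}_i$, $1 \le i \le r$, such that $$\big|\gamma\big((w_1 \circ \mathrm{Emb}(n_1, \mathcal{C}_1)) \times \cdots \times (w_r \circ \mathrm{Emb}(n_r, \mathcal{C}_r))\big)\big| \le N.$$
   Context: A chain is a linearly ordered set. A positive integer $n$ is identified with the finite chain $0 < 1 < \cdots < n-1$. $\mathrm{Emb}(\mathcal{A},\mathcal{B})$ is the set of all embeddings (strictly order-preserving maps) of the chain $\mathcal{A}$ into the chain $\mathcal{B}$, and $w \circ \mathrm{Emb}(\mathcal{A},\mathcal{B}) = \{w \circ f : f \in \mathrm{Emb}(\mathcal{A},\mathcal{B})\}$. For a chain $\mathcal{C}$, $T(n,\mathcal{C})$ is the least positive integer $t$ such that for every positive integer $k$ and every coloring $\chi : \mathrm{Emb}(n,\mathcal{C}) \to \{0,\ldots,k-1\}$ there is a $w \in \mathrm{Emb}(\mathcal{C},\mathcal{C})$ with $|\chi(w \circ \mathrm{Emb}(n,\mathcal{C}))| \le t$; if no such $t$ exists, $T(n,\mathcal{C}) = \infty$. The chain $\mathcal{C}$ has finite big Ramsey spectrum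 if $T(n,\mathcal{C}) < \infty$ for all $n \ge 1$. *)

theory Defs
  imports Main "HOL-Library.FuncSet" "HOL-Library.Countable_Set" "HOL-Library.Extended_Nat"
begin

text \<open>
  A chain is a reflexive linear order \<^term>\<open>C :: 'a rel\<close> with \<^term>\<open>Linear_order C\<close>; its carrier is
  \<^term>\<open>Field C\<close>. The finite chain \<open>0 < 1 < \<dots> < n - 1\<close> is \<^term>\<open>natLeq_on n\<close>. Embeddings are
  extensional functions on the carrier, so that each one is a single element of \<open>Emb A B\<close>.
\<close>

definition Emb :: "'a rel \<Rightarrow> 'b rel \<Rightarrow> ('a \<Rightarrow> 'b) set" where
  "Emb A B = {f \<in> Field A \<rightarrow>\<^sub>E Field B.
     \<forall>x y. (x, y) \<in> A \<and> x \<noteq> y \<longrightarrow> (f x, f y) \<in> B \<and> f x \<noteq> f y}"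

text \<open>The set \<open>w \<circ> Emb(A, B)\<close>; \<^const>\<open>compose\<close> keeps the composites extensional.\<close>

definition comp_Emb :: "('b \<Rightarrow> 'c) \<Rightarrow> 'a rel \<Rightarrow> 'b rel \<Rightarrow> ('a \<Rightarrow> 'c) set" where
  "comp_Emb w A B = compose (Field A) w ` Emb A B"

definition big_Ramsey_bound :: "nat \<Rightarrow> 'a rel \<Rightarrow> nat \<Rightarrow> bool" where
  "big_Ramsey_bound n C t \<longleftrightarrow>
     (\<forall>k\<ge>1. \<forall>\<chi> \<in> Emb (natLeq_on n) C \<rightarrow> {..<k::nat}.
        \<exists>w \<in> Emb C C. card (\<chi> ` comp_Emb w (natLeq_on n) C) \<le> t)"

definition big_Ramsey_degree :: "nat \<Rightarrow> 'a rel \<Rightarrow> enat" where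
  "big_Ramsey_degree n C =
     (if \<exists>t\<ge>1. big_Ramsey_bound n C t
      then enat (LEAST t. t \<ge> 1 \<and> big_Ramsey_bound n C t) else \<infinity>)"

definition finite_big_Ramsey_spectrum :: "'a rel \<Rightarrow> bool" where
  "finite_big_Ramsey_spectrum C \<longleftrightarrow> (\<forall>n\<ge>1. big_Ramsey_degree n C < \<infinity>)"

end

theory Submission
  imports Defs "HOL.Rat" "HOL-Library.Ramsey" "HOL-Library.Nat_Bijection"
begin

text \<open>
  Countable chains are realized as sets of rationals. A set that is not scattered contains a copy of
  every countable chain. A scattered set is the set of leaves of a well-founded tree in which the
  children of a node are ordered along \<open>\<omega>\<close> or its reverse; colouring a pair of points by the number
  of alternations between the two paths leading to them shows that a scattered set with finite big
  Ramsey degrees is equimorphic to one of finite rank, since any set of infinite rank realizes every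
  number of alternations. In finite rank only finitely many types of summands occur, so the points
  can be coded by boundedly many natural numbers in such a way that every infinite \<open>M \<subseteq> \<nat>\<close> codes a
  copy of the whole set. A colouring of the product thus becomes a colouring of the \<open>m\<close>-subsets of
  \<open>\<nat>\<close>. If all the chains are scattered, Ramsey's theorem yields \<open>M\<close>; otherwise one enumerates a
  chain that is not scattered, lets \<open>M\<close> range over its copies inside itself, and uses its finite
  big Ramsey degrees.
\<close>

section \<open>Sums of sets of rationals\<close>

text \<open>The embeddings \<open>w i\<close> have to be found together, while each hypothesis
  speaks of one chain only. Hence they are all read off one set \<open>M\<close>, and a single
  family of sets of naturals has to fit every coordinate. What makes this work is that codes have
  bounded size: a tuple of points then involves at most a fixed number of naturals, however many
  colours are used. Each level of rank lengthens the codes, and this is where the finite degrees of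
  a scattered chain are needed. They give enough because the bound for pairs is fixed before the
  colouring is chosen: if a colouring uses more colours than the bound, some copy loses one of them.
  The codes are plain sets without marks on their elements. Decoding a set in all possible ways at
  once still yields boundedly many points, and since a larger set codes more points, all codes of a
  tuple can be merged and padded to one common size.\<close>

definition embeds :: "rat set \<Rightarrow> rat set \<Rightarrow> bool"  (infix "\<preceq>" 50)
  where "X \<preceq> Y \<longleftrightarrow> (\<exists>f. strict_mono_on X f \<and> f ` X \<subseteq> Y)"

lemma embedsI: "(\<And>x y. x \<in> X \<Longrightarrow> y \<in> X \<Longrightarrow> x < y \<Longrightarrow> f x < f y) \<Longrightarrow> (\<And>x. x \<in> X \<Longrightarrow> f x \<in> Y) \<Longrightarrow> X \<preceq> Y"
  unfolding embeds_def strict_mono_on_def by blast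

lemma embedsE:
  assumes "X \<preceq> Y"
  obtains f where "\<And>x y. x \<in> X \<Longrightarrow> y \<in> X \<Longrightarrow> x < y \<Longrightarrow> f x < f y" "\<And>x. x \<in> X \<Longrightarrow> f x \<in> Y"
  using assms unfolding embeds_def strict_mono_on_def by blast

lemma embeds_subset: "X \<subseteq> Y \<Longrightarrow> X \<preceq> Y"
  by (rule embedsI[of _ "\<lambda>x. x"]) auto

lemma embeds_trans:
  assumes "X \<preceq> Y" "Y \<preceq> Z"
  shows "X \<preceq> Z"
proof -
  obtain f where f: "\<And>x y. x \<in> X \<Longrightarrow> y \<in> X \<Longrightarrow> x < y \<Longrightarrow> f x < f y" "\<And>x. x \<in> X \<Longrightarrow> f x \<in> Y"
    using embedsE[OF assms(1)] by blast
  obtain g where g: "\<And>x y. x \<in> Y \<Longrightarrow> y \<in> Y \<Longrightarrow> x < y \<Longrightarrow> g x < g y" "\<And>x. x \<in> Y \<Longrightarrow> g x \<in> Z"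
    using embedsE[OF assms(2)] by blast
  show ?thesis by (rule embedsI[of _ "\<lambda>x. g (f x)"]) (simp_all add: f g)
qed

definition equimorphic :: "rat set \<Rightarrow> rat set \<Rightarrow> bool"  (infix "\<simeq>" 50)
  where "X \<simeq> Y \<longleftrightarrow> X \<preceq> Y \<and> Y \<preceq> X"

definition before :: "rat set \<Rightarrow> rat set \<Rightarrow> bool"
  where "before A B \<longleftrightarrow> (\<forall>a\<in>A. \<forall>b\<in>B. a < b)"

lemma before_mono: "before A B \<Longrightarrow> A' \<subseteq> A \<Longrightarrow> B' \<subseteq> B \<Longrightarrow> before A' B'"
  unfolding before_def by blast

lemma embeds_Un:
  assumes "before A B" "before A' B'" "A \<preceq> A'" "B \<preceq> B'"
  shows "A \<union> B \<preceq> A' \<union> B'"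
proof -
  obtain f where f: "\<And>x y. x \<in> A \<Longrightarrow> y \<in> A \<Longrightarrow> x < y \<Longrightarrow> f x < f y" "\<And>x. x \<in> A \<Longrightarrow> f x \<in> A'"
    using embedsE[OF assms(3)] by blast
  obtain g where g: "\<And>x y. x \<in> B \<Longrightarrow> y \<in> B \<Longrightarrow> x < y \<Longrightarrow> g x < g y" "\<And>x. x \<in> B \<Longrightarrow> g x \<in> B'"
    using embedsE[OF assms(4)] by blast
  show ?thesis
  proof (rule embedsI)
    show "(if x \<in> A then f x else g x) < (if y \<in> A then f y else g y)"
      if "x \<in> A \<union> B" "y \<in> A \<union> B" "x < y" for x y
      using that f g assms(1,2) unfolding before_def by (auto dest: order.asym)
  qed (use f g in auto)
qed

text \<open>The flag selects sums along \<open>\<omega>\<close> (true) or along its reverse (false); summands may be empty.\<close>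

definition ordered_sum :: "bool \<Rightarrow> (nat \<Rightarrow> rat set) \<Rightarrow> bool"
  where "ordered_sum b A \<longleftrightarrow>
    (\<forall>i j. i < j \<longrightarrow> (if b then before (A i) (A j) else before (A j) (A i)))"

lemma ordered_sum_mono: "ordered_sum b A \<Longrightarrow> (\<And>i. B i \<subseteq> A i) \<Longrightarrow> ordered_sum b B"
  unfolding ordered_sum_def by (simp split: if_splits) (metis before_mono)

lemma ordered_sum_disjoint:
  assumes "ordered_sum b A" "x \<in> A i" "x \<in> A j"
  shows "i = j"
proof (rule ccontr)
  assume "i \<noteq> j"
  then have "i < j \<or> j < i" by auto
  then have "before (A i) (A j) \<or> before (A j) (A i)"
    using assms(1) unfolding ordered_sum_def by metis
  then show False using assms(2,3) unfolding before_def by blast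
qed

lemma ordered_sum_less:
  assumes "ordered_sum b A" "x \<in> A i" "y \<in> A j" "i \<noteq> j"
  shows "x < y \<longleftrightarrow> (if b then i < j else j < i)"
  using assms unfolding ordered_sum_def before_def
  by (metis linorder_neqE_nat order.asym)

lemma ordered_sum_before:
  assumes "ordered_sum b A" "\<And>i j. i \<in> I \<Longrightarrow> j \<in> J \<Longrightarrow> i < j"
  shows "if b then before (\<Union>i\<in>I. A i) (\<Union>j\<in>J. A j) else before (\<Union>j\<in>J. A j) (\<Union>i\<in>I. A i)"
proof -
  have "if b then x < y else y < x" if "i \<in> I" "j \<in> J" "x \<in> A i" "y \<in> A j" for i j x y
  proof -
    have "i < j" using assms(2) that by blast
    then show ?thesis using assms(1) that(3,4) unfolding ordered_sum_def before_def by (simp split: if_splits)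
  qed
  then show ?thesis unfolding before_def by (cases b) auto
qed

text \<open>Greedy placement: each summand goes into a finite segment of \<open>Y\<close> that
  starts beyond all segments used before. Points of different summands are compared through their
  indices alone, so one argument serves both directions.\<close>

lemma ordered_sum_embeds:
  assumes X: "ordered_sum b X" and Y: "ordered_sum b Y"
    and ex: "\<And>l N. \<exists>N'. X l \<preceq> (\<Union>j\<in>{N..<N'}. Y j)"
  shows "(\<Union>l. X l) \<preceq> (\<Union>j. Y j)"
proof -
  obtain e where e: "\<And>l N. X l \<preceq> (\<Union>j\<in>{N..<e l N}. Y j)"
    using ex by metis
  define g where "g l N = (SOME f. strict_mono_on (X l) f \<and> f ` X l \<subseteq> (\<Union>j\<in>{N..<e l N}. Y j))" for l N
  have "strict_mono_on (X l) (g l N) \<and> g l N ` X l \<subseteq> (\<Union>j\<in>{N..<e l N}. Y j)" for l N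
    using e[of l N] unfolding g_def embeds_def by (rule someI_ex)
  then have g: "\<And>l N x y. x \<in> X l \<Longrightarrow> y \<in> X l \<Longrightarrow> x < y \<Longrightarrow> g l N x < g l N y"
      "\<And>l N x. x \<in> X l \<Longrightarrow> g l N x \<in> (\<Union>j\<in>{N..<e l N}. Y j)"
    by (auto simp: strict_mono_on_def image_subset_iff)
  \<comment> \<open>The maximum keeps \<open>s\<close> nondecreasing when \<open>e l sl\<close> is
    below \<open>sl\<close>, which can only happen for an empty \<open>X l\<close>.\<close>
  define s where "s = rec_nat 0 (\<lambda>l sl. max sl (e l sl))"
  have s: "s (Suc l) = max (s l) (e l (s l))" for l by (simp add: s_def)
  have mono: "s i \<le> s j" if "i \<le> j" for i j
    using that by (induct rule: dec_induct) (auto simp: s)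
  define idx where "idx x = (SOME l. x \<in> X l)" for x
  have idx: "idx x = l" if "x \<in> X l" for x l
    unfolding idx_def by (rule some_equality) (use that ordered_sum_disjoint[OF X] in auto)
  let ?f = "\<lambda>x. g (idx x) (s (idx x)) x"
  have f: "\<exists>j. s l \<le> j \<and> j < s (Suc l) \<and> ?f x \<in> Y j" if "x \<in> X l" for x l
    using g(2)[OF that, of "s l"] unfolding s idx[OF that] by fastforce
  show ?thesis
  proof (rule embedsI)
    fix x y assume "x \<in> (\<Union>l. X l)" "y \<in> (\<Union>l. X l)" and less: "x < y"
    then obtain l l' where l: "x \<in> X l" "y \<in> X l'" by blast
    show "?f x < ?f y"
    proof (cases "l = l'")
      case True
      then show ?thesis using g(1) l less by (simp add: idx)
    next
      case False
      obtain j where j: "s l \<le> j" "j < s (Suc l)" "?f x \<in> Y j" using f l by blast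
      obtain j' where j': "s l' \<le> j'" "j' < s (Suc l')" "?f y \<in> Y j'" using f l by blast
      have 1: "l < l' \<Longrightarrow> j < j'" using j j' mono[of "Suc l" l'] by linarith
      have 2: "l' < l \<Longrightarrow> j' < j" using j j' mono[of "Suc l'" l] by linarith
      show ?thesis using ordered_sum_less[OF X l False] 1 2 False less ordered_sum_less[OF Y j(3) j'(3)]
        by (cases b) auto
    qed
  qed (use f in blast)
qed

section \<open>Finite concatenations and their absorption by sums with recurring summands\<close>

inductive finite_sum :: "(rat set \<Rightarrow> bool) \<Rightarrow> rat set \<Rightarrow> bool" for Q where
  empty: "finite_sum Q {}"
| Cons: "Q A \<Longrightarrow> finite_sum Q B \<Longrightarrow> before A B \<Longrightarrow> finite_sum Q (A \<union> B)"

lemma finite_sum_single: "Q A \<Longrightarrow> finite_sum Q A"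
  using finite_sum.Cons[OF _ finite_sum.empty, of Q A] by (simp add: before_def)

lemma finite_sum_append:
  assumes "finite_sum Q A" "finite_sum Q B" "before A B"
  shows "finite_sum Q (A \<union> B)"
  using assms
proof (induct rule: finite_sum.induct)
  case (Cons A A')
  then have "finite_sum Q (A' \<union> B)" using before_mono[of "A \<union> A'" B A' B] by auto
  moreover have "before A (A' \<union> B)" using Cons by (auto simp: before_def)
  ultimately show ?case using finite_sum.Cons[of Q A] Cons by (simp add: Un_assoc)
qed simp

lemma finite_sum_mono: "finite_sum Q A \<Longrightarrow> (\<And>Z. Z \<subseteq> A \<Longrightarrow> Q Z \<Longrightarrow> Q' Z) \<Longrightarrow> finite_sum Q' A"
  by (induct rule: finite_sum.induct) (auto intro: finite_sum.intros)

text \<open>Every member of \<open>S\<close> can be found again beyond any index, so the pieces of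
  \<open>W\<close> are placed one after the other.\<close>

lemma finite_sum_absorbed:
  assumes Y: "ordered_sum b Y" and rec: "\<And>s N. s \<in> S \<Longrightarrow> \<exists>j\<ge>N. s \<preceq> Y j"
    and W: "finite_sum (\<lambda>Z. \<exists>s\<in>S. Z \<preceq> s) W"
  shows "\<exists>N'. W \<preceq> (\<Union>j\<in>{N..<N'}. Y j)"
  using W
proof (induct arbitrary: N rule: finite_sum.induct)
  case empty
  show ?case by (auto intro: embeds_subset)
next
  case (Cons A B)
  then obtain s where s: "s \<in> S" "A \<preceq> s" by blast
  show ?case
  proof (cases b)
    case True
    obtain j where j: "j \<ge> N" "s \<preceq> Y j" using rec[OF s(1)] by blast
    obtain N' where N': "B \<preceq> (\<Union>j\<in>{Suc j..<N'}. Y j)" using Cons(3) by blast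
    have "before (Y j) (\<Union>j\<in>{Suc j..<N'}. Y j)"
      using ordered_sum_before[OF Y, of "{j}" "{Suc j..<N'}"] True by simp
    then have "A \<union> B \<preceq> Y j \<union> (\<Union>j\<in>{Suc j..<N'}. Y j)"
      using embeds_Un Cons(4) N' embeds_trans[OF s(2) j(2)] by blast
    also have "\<dots> \<preceq> (\<Union>j\<in>{N..<max N' (Suc j)}. Y j)"
      using j(1) by (intro embeds_subset) fastforce
    finally (embeds_trans) show ?thesis by blast
  next
    case False
    \<comment> \<open>Along the reversed order the leftmost piece needs the largest index, so the
      remaining pieces are placed first. The maximum below is there because \<open>N'\<close> may
      lie below \<open>N\<close>.\<close>
    obtain N' where N': "B \<preceq> (\<Union>j\<in>{N..<N'}. Y j)" using Cons(3) by blast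
    obtain j where j: "j \<ge> max N N'" "s \<preceq> Y j" using rec[OF s(1)] by blast
    have "before (Y j) (\<Union>j\<in>{N..<N'}. Y j)"
      using ordered_sum_before[OF Y, of "{N..<N'}" "{j}"] False j(1) by simp
    then have "A \<union> B \<preceq> Y j \<union> (\<Union>j\<in>{N..<N'}. Y j)"
      using embeds_Un Cons(4) N' embeds_trans[OF s(2) j(2)] by blast
    also have "\<dots> \<preceq> (\<Union>j\<in>{N..<Suc j}. Y j)"
      using j(1) by (intro embeds_subset) fastforce
    finally (embeds_trans) show ?thesis by blast
  qed
qed

lemma ordered_sum_absorbed:
  assumes "ordered_sum b X" "ordered_sum b Y"
    and "\<And>l. finite_sum (\<lambda>Z. \<exists>s\<in>S. Z \<preceq> s) (X l)"
    and "\<And>s N. s \<in> S \<Longrightarrow> \<exists>j\<ge>N. s \<preceq> Y j"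
  shows "(\<Union>l. X l) \<preceq> (\<Union>j. Y j)"
  using ordered_sum_embeds[OF assms(1,2)] finite_sum_absorbed[OF assms(2,4,3)] by blast

text \<open>\<open>Q\<close> is only known to be closed under joining two sets, so the initial
  summands are joined to the tail one at a time, the last of them first.\<close>

lemma ordered_sum_split:
  assumes A: "ordered_sum b A"
    and Q: "\<And>A B. Q A \<Longrightarrow> Q B \<Longrightarrow> before A B \<Longrightarrow> Q (A \<union> B)"
    and hd: "\<And>i. i < L \<Longrightarrow> Q (A i)" and tl: "Q (\<Union>i. A (i + L))"
  shows "Q (\<Union>i. A i)"
proof -
  have "Q (\<Union>i\<in>{l..}. A i)" if "l \<le> L" for l
    using that
  proof (induct rule: inc_induct)
    case base
    have "{L..} = range (\<lambda>i. i + L)"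
      by (auto simp: image_def) (metis le_add_diff_inverse2)
    then show ?case using tl by (simp add: image_image)
  next
    case (step l)
    have eq: "(\<Union>i\<in>{l..}. A i) = A l \<union> (\<Union>i\<in>{Suc l..}. A i)"
      using atLeast_Suc_greaterThan[of l] ivl_disj_un_singleton(1)[of l] by auto
    have "if b then before (A l) (\<Union>i\<in>{Suc l..}. A i) else before (\<Union>i\<in>{Suc l..}. A i) (A l)"
      using ordered_sum_before[OF A, of "{l}" "{Suc l..}"] by (cases b) simp_all
    then show ?case unfolding eq using Q[of "A l" "\<Union>i\<in>{Suc l..}. A i"] Q[of "\<Union>i\<in>{Suc l..}. A i" "A l"] hd step
      by (cases b) (auto simp: Un_commute)
  qed
  from this[of 0] show ?thesis by (simp add: atLeast_def)
qed

section \<open>Codings by finite sets of natural numbers\<close>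

text \<open>A set \<open>S\<close> codes the boundedly many points \<open>pts S\<close>; for each \<open>M \<in> \<M>\<close> the points with a code of
  size at most \<open>d\<close> in \<open>M\<close> contain a copy of the whole set.\<close>

definition coded_points :: "(nat set \<Rightarrow> rat set) \<Rightarrow> nat \<Rightarrow> nat set \<Rightarrow> rat set"
  where "coded_points pts d M = \<Union>{pts S | S. finite S \<and> S \<subseteq> M \<and> card S \<le> d}"

definition coding :: "nat set set \<Rightarrow> rat set \<Rightarrow> (nat set \<Rightarrow> rat set) \<Rightarrow> nat \<Rightarrow> (nat \<Rightarrow> nat) \<Rightarrow> bool"
  where "coding \<M> X pts d B \<longleftrightarrow>
    (\<forall>S. finite S \<longrightarrow> finite (pts S) \<and> card (pts S) \<le> B (card S)) \<and>
    (\<forall>S T. S \<subseteq> T \<longrightarrow> pts S \<subseteq> pts T) \<and>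
    (\<forall>M\<in>\<M>. X \<preceq> X \<inter> coded_points pts d M)"

definition coded :: "nat set set \<Rightarrow> rat set \<Rightarrow> bool"
  where "coded \<M> X \<longleftrightarrow> (\<exists>pts d B. coding \<M> X pts d B)"

lemma coded_pointsI: "x \<in> pts S \<Longrightarrow> finite S \<Longrightarrow> S \<subseteq> M \<Longrightarrow> card S \<le> d \<Longrightarrow> x \<in> coded_points pts d M"
  unfolding coded_points_def by blast

lemma coded_pointsE:
  assumes "x \<in> coded_points pts d M"
  obtains S where "x \<in> pts S" "finite S" "S \<subseteq> M" "card S \<le> d"
  using assms unfolding coded_points_def by blast

lemma codedI:
  assumes "\<And>S. finite S \<Longrightarrow> finite (pts S)" "\<And>S. finite S \<Longrightarrow> card (pts S) \<le> B (card S)"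
    "\<And>S T. S \<subseteq> T \<Longrightarrow> pts S \<subseteq> pts T" "\<And>M. M \<in> \<M> \<Longrightarrow> X \<preceq> X \<inter> coded_points pts d M"
  shows "coded \<M> X"
  unfolding coded_def coding_def
  by (rule exI[of _ pts], rule exI[of _ d], rule exI[of _ B]) (simp add: assms)

lemma codingD:
  assumes "coding \<M> X pts d B"
  shows "\<And>S. finite S \<Longrightarrow> finite (pts S)" "\<And>S. finite S \<Longrightarrow> card (pts S) \<le> B (card S)"
    "\<And>S T. S \<subseteq> T \<Longrightarrow> pts S \<subseteq> pts T" "\<And>M. M \<in> \<M> \<Longrightarrow> X \<preceq> X \<inter> coded_points pts d M"
  using assms unfolding coding_def by simp_all

lemma coded_empty: "coded \<M> {}"
  by (rule codedI[of "\<lambda>_. {}" "\<lambda>_. 0"]) (auto intro: embeds_subset)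

lemma coded_singleton: "coded \<M> {x}"
  by (rule codedI[of "\<lambda>_. {x}" "\<lambda>_. 1" _ _ 0])
    (auto intro!: embeds_subset coded_pointsI[of _ _ "{}"])

lemma coded_equimorphic:
  assumes "coded \<M> X" "X \<simeq> Y"
  shows "coded \<M> Y"
proof -
  obtain pts d B where "coding \<M> X pts d B" using assms(1) unfolding coded_def by blast
  note pts = codingD[OF this]
  have "X \<preceq> Y" "Y \<preceq> X" using assms(2) unfolding equimorphic_def by blast+
  obtain f where f: "\<And>x y. x \<in> X \<Longrightarrow> y \<in> X \<Longrightarrow> x < y \<Longrightarrow> f x < f y" "\<And>x. x \<in> X \<Longrightarrow> f x \<in> Y"
    using embedsE[OF \<open>X \<preceq> Y\<close>] by blast
  show ?thesis
  proof (rule codedI)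
    fix M assume M: "M \<in> \<M>"
    have "X \<inter> coded_points pts d M \<preceq> Y \<inter> coded_points (\<lambda>S. f ` pts S) d M"
      by (rule embedsI[of _ f]) (auto simp: f elim!: coded_pointsE intro!: coded_pointsI)
    then show "Y \<preceq> Y \<inter> coded_points (\<lambda>S. f ` pts S) d M"
      using embeds_trans pts(4)[OF M] \<open>Y \<preceq> X\<close> by blast
  next
    fix S :: "nat set" assume "finite S"
    then show "card (f ` pts S) \<le> B (card S)"
      using order_trans[OF card_image_le[OF pts(1)] pts(2)] by blast
  next
    fix S T :: "nat set" assume "S \<subseteq> T"
    then show "f ` pts S \<subseteq> f ` pts T" using pts(3) by (intro image_mono)
  qed (simp add: pts(1))
qed

lemma coded_Un:
  assumes "coded \<M> X" "coded \<M> Y" "before X Y"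
  shows "coded \<M> (X \<union> Y)"
proof -
  obtain p1 d1 B1 where "coding \<M> X p1 d1 B1" using assms(1) unfolding coded_def by blast
  note 1 = codingD[OF this]
  obtain p2 d2 B2 where "coding \<M> Y p2 d2 B2" using assms(2) unfolding coded_def by blast
  note 2 = codingD[OF this]
  let ?p = "\<lambda>S. p1 S \<union> p2 S"
  show ?thesis
  proof (rule codedI[where pts = ?p and d = "max d1 d2" and B = "\<lambda>c. B1 c + B2 c"])
    fix M assume M: "M \<in> \<M>"
    have "before (X \<inter> coded_points p1 d1 M) (Y \<inter> coded_points p2 d2 M)"
      using before_mono[OF assms(3)] by blast
    then have "X \<union> Y \<preceq> X \<inter> coded_points p1 d1 M \<union> Y \<inter> coded_points p2 d2 M"
      using embeds_Un[OF assms(3)] 1(4) 2(4) M by blast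
    also have "\<dots> \<preceq> (X \<union> Y) \<inter> coded_points ?p (max d1 d2) M"
      by (rule embeds_subset) (auto elim!: coded_pointsE intro!: coded_pointsI)
    finally (embeds_trans) show "X \<union> Y \<preceq> (X \<union> Y) \<inter> coded_points ?p (max d1 d2) M" .
  next
    fix S :: "nat set" assume "finite S"
    then show "card (?p S) \<le> B1 (card S) + B2 (card S)"
      using card_Un_le[of "p1 S" "p2 S"] 1(2)[of S] 2(2)[of S] by linarith
  next
    fix S T :: "nat set" assume "S \<subseteq> T"
    then show "?p S \<subseteq> ?p T" using 1(3) 2(3) by (simp add: le_supI1 le_supI2)
  qed (simp add: 1(1) 2(1))
qed

lemma coded_finite_sum: "finite_sum (coded \<M>) X \<Longrightarrow> coded \<M> X"
  by (induct rule: finite_sum.induct) (auto intro: coded_empty coded_Un)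

section \<open>Sums in which every type of summand recurs\<close>

definition regular_sum :: "bool \<Rightarrow> rat set set \<Rightarrow> rat set \<Rightarrow> bool"
  where "regular_sum b S X \<longleftrightarrow> (\<exists>A. ordered_sum b A \<and> X = (\<Union>l. A l) \<and>
    (\<forall>l. finite_sum (\<lambda>Z. \<exists>s\<in>S. Z \<preceq> s) (A l)) \<and> (\<forall>s\<in>S. \<forall>N. \<exists>j\<ge>N. s \<preceq> A j))"

text \<open>Each sum absorbs the other, because the pieces of one fit into letters that recur in the
  other. So the direction and the set of recurring letters are the only invariants.\<close>

lemma regular_sum_equimorphic: "regular_sum b S X \<Longrightarrow> regular_sum b S Y \<Longrightarrow> X \<simeq> Y"
  unfolding regular_sum_def equimorphic_def
  by (elim exE conjE, hypsubst, intro conjI ordered_sum_absorbed[where S = S]) simp_all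

text \<open>A natural number \<open>m\<close> names, for each letter, a copy in a summand of index
  at least \<open>m\<close>. An infinite \<open>M\<close> contains arbitrarily large names, so every
  letter still recurs among the coded points, and absorption embeds the whole sum.\<close>

lemma regular_sum_coded:
  assumes inf: "\<forall>M\<in>\<M>. infinite M"
    and S: "finite S" "\<And>s. s \<in> S \<Longrightarrow> coded \<M> s" and X: "regular_sum b S X"
  shows "coded \<M> X"
proof -
  obtain A where A: "ordered_sum b A" "X = (\<Union>l. A l)"
    "\<And>l. finite_sum (\<lambda>Z. \<exists>s\<in>S. Z \<preceq> s) (A l)" "\<And>s N. s \<in> S \<Longrightarrow> \<exists>j\<ge>N. s \<preceq> A j"
    using X unfolding regular_sum_def by blast
  obtain p d B where c: "\<And>s. s \<in> S \<Longrightarrow> coding \<M> s (p s) (d s) (B s)"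
    using S(2) unfolding coded_def by metis
  note fin = codingD(1)[OF c] and bound = codingD(2)[OF c]
    and mono = codingD(3)[OF c] and cover = codingD(4)[OF c]
  obtain slot where slot: "\<And>s m. s \<in> S \<Longrightarrow> slot s m \<ge> m \<and> s \<preceq> A (slot s m)"
    using A(4) by metis
  define f where "f s m = (SOME f. strict_mono_on s f \<and> f ` s \<subseteq> A (slot s m))" for s m
  have f: "strict_mono_on s (f s m)" "f s m ` s \<subseteq> A (slot s m)" if "s \<in> S" for s m
    using someI_ex[of "\<lambda>f. strict_mono_on s f \<and> f ` s \<subseteq> A (slot s m)"] slot[OF that]
    unfolding f_def embeds_def by blast+
  \<comment> \<open>The set \<open>T\<close> supplies both the name \<open>m\<close> and the code
    inside the letter. Letting every element be the name avoids recording which one is meant and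
    keeps \<open>pts\<close> monotone; the price is a factor \<open>card T\<close> and a sum over
    the letters.\<close>
  define pts where "pts T = (\<Union>m\<in>T. \<Union>s\<in>S. f s m ` (s \<inter> p s T))" for T
  \<comment> \<open>The sum bounds all \<open>d s\<close> at once, also for empty \<open>S\<close>;
    the successor makes room for the name \<open>m\<close>.\<close>
  define D where "D = Suc (\<Sum>s\<in>S. d s)"
  have d_le: "Suc (d s) \<le> D" if "s \<in> S" for s
    unfolding D_def using member_le_sum[OF that, of d] S(1) by simp
  show ?thesis
  proof (rule codedI[where pts = pts and d = D and B = "\<lambda>c. c * (\<Sum>s\<in>S. B s c)"])
    fix T :: "nat set" assume T: "finite T"
    show "finite (pts T)"
      unfolding pts_def using T S(1) fin by (intro finite_UN_I finite_imageI finite_Int disjI2)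
    have "card (pts T) \<le> (\<Sum>m\<in>T. card (\<Union>s\<in>S. f s m ` (s \<inter> p s T)))"
      unfolding pts_def by (rule card_UN_le[OF T])
    also have "\<dots> \<le> (\<Sum>m\<in>T. \<Sum>s\<in>S. B s (card T))"
    proof (rule sum_mono)
      fix m
      have "card (\<Union>s\<in>S. f s m ` (s \<inter> p s T)) \<le> (\<Sum>s\<in>S. card (f s m ` (s \<inter> p s T)))"
        by (rule card_UN_le[OF S(1)])
      also have "\<dots> \<le> (\<Sum>s\<in>S. B s (card T))"
      proof (rule sum_mono)
        fix s assume s: "s \<in> S"
        have "card (f s m ` (s \<inter> p s T)) \<le> card (p s T)"
          using fin[OF s T] by (intro order_trans[OF card_image_le card_mono]) auto
        then show "card (f s m ` (s \<inter> p s T)) \<le> B s (card T)" using bound[OF s T] by simp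
      qed
      finally show "card (\<Union>s\<in>S. f s m ` (s \<inter> p s T)) \<le> (\<Sum>s\<in>S. B s (card T))" .
    qed
    finally show "card (pts T) \<le> card T * (\<Sum>s\<in>S. B s (card T))" by simp
  next
    fix T T' :: "nat set" assume "T \<subseteq> T'"
    then have "\<And>s. s \<in> S \<Longrightarrow> p s T \<subseteq> p s T'" using mono by blast
    with \<open>T \<subseteq> T'\<close> show "pts T \<subseteq> pts T'" unfolding pts_def by (intro UN_mono image_mono Int_mono) auto
  next
    fix M assume M: "M \<in> \<M>"
    let ?G = "coded_points pts D M"
    have rec: "\<exists>j\<ge>N. s \<preceq> A j \<inter> ?G" if s: "s \<in> S" for s N
    proof -
      obtain m where m: "m \<in> M" "m \<ge> N"
        using inf M by (meson infinite_nat_iff_unbounded_le)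
      have "s \<inter> coded_points (p s) (d s) M \<preceq> A (slot s m) \<inter> ?G"
      proof (rule embedsI[of _ "f s m"])
        show "f s m x < f s m y" if "x \<in> s \<inter> coded_points (p s) (d s) M"
          "y \<in> s \<inter> coded_points (p s) (d s) M" "x < y" for x y
          using strict_mono_onD[OF f(1)[OF s]] that by blast
        fix x assume x: "x \<in> s \<inter> coded_points (p s) (d s) M"
        then obtain T where T: "x \<in> p s T" "finite T" "T \<subseteq> M" "card T \<le> d s"
          by (auto elim: coded_pointsE)
        have "f s m x \<in> ?G"
        proof (rule coded_pointsI)
          show "f s m x \<in> pts (insert m T)"
            unfolding pts_def using x T(1) mono[OF s subset_insertI[of T m]] s
            by (intro UN_I[of m] UN_I[of s] imageI) auto
          show "card (insert m T) \<le> D"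
            using card_insert_le_m1[of "Suc (d s)" T m] T(4) d_le[OF s] by simp
        qed (use T m in auto)
        then show "f s m x \<in> A (slot s m) \<inter> ?G" using x f(2)[OF s, of m] by blast
      qed
      then have "s \<preceq> A (slot s m) \<inter> ?G" using cover[OF s M] embeds_trans by blast
      then show ?thesis using slot[OF s, of m] m(2) order_trans by blast
    qed
    have "X \<preceq> (\<Union>j. A j \<inter> ?G)"
      unfolding A(2)
      by (rule ordered_sum_absorbed[OF A(1) _ A(3) rec]) (auto intro: ordered_sum_mono[OF A(1)])
    then show "X \<preceq> X \<inter> ?G" unfolding A(2) by simp
  qed
qed

section \<open>Sets of finite rank and their finitely many types\<close>

fun finite_rank :: "nat \<Rightarrow> rat set \<Rightarrow> bool" where
  "finite_rank 0 X \<longleftrightarrow> X = {} \<or> (\<exists>x. X = {x})"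
| "finite_rank (Suc n) X \<longleftrightarrow>
     finite_sum (\<lambda>Z. \<exists>b A. ordered_sum b A \<and> (\<forall>i. finite_rank n (A i)) \<and> Z = (\<Union>i. A i)) X"

text \<open>Finite concatenations are built into every positive level for the sake of this closure:
  it lets finitely many exceptional summands be joined to a tail.\<close>

lemma finite_rank_Suc_Un:
  "finite_rank (Suc n) X \<Longrightarrow> finite_rank (Suc n) Y \<Longrightarrow> before X Y \<Longrightarrow> finite_rank (Suc n) (X \<union> Y)"
  by (simp add: finite_sum_append)

lemma finite_rank_ordered_sum:
  "ordered_sum b A \<Longrightarrow> (\<And>i. finite_rank n (A i)) \<Longrightarrow> finite_rank (Suc n) (\<Union>i. A i)"
  by (auto intro!: finite_sum_single)

lemma finite_rank_empty: "finite_rank n {}"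
  by (cases n) (auto intro: finite_sum.empty)

lemma finite_rank_Suc:
  assumes "finite_rank n X"
  shows "finite_rank (Suc n) X"
proof -
  let ?A = "\<lambda>i::nat. if i = 0 then X else {}"
  have "ordered_sum True ?A" by (auto simp: ordered_sum_def before_def)
  then have "finite_rank (Suc n) (\<Union>i. ?A i)"
    by (rule finite_rank_ordered_sum) (use assms finite_rank_empty in auto)
  then show ?thesis by (simp split: if_splits)
qed

lemma finite_rank_subsingleton: "X \<subseteq> {x} \<Longrightarrow> finite_rank n X"
  by (induct n) (auto simp: subset_singleton_iff simp del: finite_rank.simps(2) intro: finite_rank_Suc)

lemma ordered_sum_shift: "ordered_sum b A \<Longrightarrow> ordered_sum b (\<lambda>i. A (i + L))"
  unfolding ordered_sum_def by simp

text \<open>Used contrapositively: if all summands have level \<open>Suc n\<close> but the sum does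
  not, then infinitely many summands fail level \<open>n\<close>. This is the source of infinite
  branching in the trees below.\<close>

lemma finite_rank_cofinite:
  assumes A: "ordered_sum b A" "\<And>i. finite_rank (Suc n) (A i)"
    and fin: "finite {i. \<not> finite_rank n (A i)}"
  shows "finite_rank (Suc n) (\<Union>i. A i)"
proof -
  obtain L where "\<And>i. \<not> finite_rank n (A i) \<Longrightarrow> i < L"
    using fin by (metis (mono_tags) finite_nat_set_iff_bounded mem_Collect_eq)
  then have "\<And>i. finite_rank n (A (i + L))" by (meson not_add_less2)
  then have "finite_rank (Suc n) (\<Union>i. A (i + L))"
    by (rule finite_rank_ordered_sum[OF ordered_sum_shift[OF A(1)]])
  then show ?thesis
    using ordered_sum_split[OF A(1), of "finite_rank (Suc n)" L] finite_rank_Suc_Un A(2) by blast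
qed

text \<open>Only finitely many equimorphism types of summands occur: in a sum along \<open>\<omega>\<close> the letters
  occurring infinitely often determine a tail up to equimorphism.\<close>

lemma finite_rank_types:
  assumes inf: "\<forall>M\<in>\<M>. infinite M"
  shows "\<exists>\<Sigma>. finite \<Sigma> \<and> (\<forall>s\<in>\<Sigma>. coded \<M> s) \<and>
    (\<forall>X. finite_rank n X \<longrightarrow> finite_sum (\<lambda>Z. \<exists>s\<in>\<Sigma>. Z \<simeq> s) X)"
proof (induct n)
  case 0
  have "finite_sum (\<lambda>Z. \<exists>s\<in>{{0}}. Z \<simeq> s) {x}" for x
    by (rule finite_sum_single)
      (auto simp: equimorphic_def intro: embedsI[of _ "\<lambda>_. 0"] embedsI[of _ "\<lambda>_. x"])
  then show ?case
    by (intro exI[of _ "{{0}}"]) (auto intro: finite_sum.empty coded_singleton)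
next
  case (Suc n)
  then obtain \<Sigma> where \<Sigma>: "finite \<Sigma>" "\<And>s. s \<in> \<Sigma> \<Longrightarrow> coded \<M> s"
    "\<And>X. finite_rank n X \<Longrightarrow> finite_sum (\<lambda>Z. \<exists>s\<in>\<Sigma>. Z \<simeq> s) X" by blast
  let ?T = "{(b, S). S \<subseteq> \<Sigma> \<and> (\<exists>X. regular_sum b S X)}"
  \<comment> \<open>One representative for each direction and each set of recurring letters. As
    \<open>\<Sigma>\<close> is finite, only finitely many new letters arise at the next
    level.\<close>
  define rep where "rep = (\<lambda>(b, S). SOME X. regular_sum b S X)"
  have rep: "regular_sum b S (rep (b, S))" if "regular_sum b S X" for b S X
    unfolding rep_def using that by (auto intro: someI)
  let ?\<Sigma> = "\<Sigma> \<union> rep ` ?T"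
  have "?T \<subseteq> UNIV \<times> Pow \<Sigma>" by blast
  then have fin: "finite ?T" using \<Sigma>(1) finite_subset[of ?T "UNIV \<times> Pow \<Sigma>"] by simp
  have cod: "coded \<M> s" if "s \<in> ?\<Sigma>" for s
  proof (cases "s \<in> \<Sigma>")
    case False
    then have "s \<in> rep ` ?T" using that by simp
    then obtain b S X where S: "S \<subseteq> \<Sigma>" "regular_sum b S X" "s = rep (b, S)" by auto
    have "coded \<M> (rep (b, S))"
    proof (rule regular_sum_coded[OF _ _ _ rep[OF S(2)]])
      show "finite S" using finite_subset[OF S(1) \<Sigma>(1)] .
      show "coded \<M> t" if "t \<in> S" for t using \<Sigma>(2) subsetD[OF S(1) that] .
    qed (rule inf)
    then show ?thesis using S(3) by simp
  qed (rule \<Sigma>(2))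
  have main: "finite_sum (\<lambda>Z. \<exists>s\<in>?\<Sigma>. Z \<simeq> s) (\<Union>i. A i)"
    if A: "ordered_sum b A" "\<And>i. finite_rank n (A i)" for b A
  proof -
    \<comment> \<open>A letter recurs if it embeds into summands of arbitrarily large index, whether
      or not it is one of their chosen pieces. Beyond the threshold \<open>L\<close> every piece is
      equimorphic to a recurring letter.\<close>
    define S where "S = {s\<in>\<Sigma>. \<forall>N. \<exists>j\<ge>N. s \<preceq> A j}"
    have "\<forall>s\<in>\<Sigma> - S. \<exists>N. \<forall>j\<ge>N. \<not> s \<preceq> A j" unfolding S_def by blast
    then obtain h where h: "\<And>s j. s \<in> \<Sigma> - S \<Longrightarrow> j \<ge> h s \<Longrightarrow> \<not> s \<preceq> A j" by metis
    define L where "L = (\<Sum>s\<in>\<Sigma>. h s)"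
    have hL: "h s \<le> L" if "s \<in> \<Sigma>" for s
      unfolding L_def using member_le_sum[OF that, of h] \<Sigma>(1) by simp
    have reg: "regular_sum b S (\<Union>i. A (i + L))"
      unfolding regular_sum_def
    proof (intro exI[of _ "\<lambda>i. A (i + L)"] conjI allI ballI)
      fix l
      show "finite_sum (\<lambda>Z. \<exists>s\<in>S. Z \<preceq> s) (A (l + L))"
      proof (rule finite_sum_mono[OF \<Sigma>(3)[OF A(2)]])
        fix Z assume Z: "Z \<subseteq> A (l + L)" "\<exists>s\<in>\<Sigma>. Z \<simeq> s"
        then obtain s where s: "s \<in> \<Sigma>" "Z \<preceq> s" "s \<preceq> Z" unfolding equimorphic_def by blast
        then have "s \<preceq> A (l + L)" using Z(1) embeds_subset embeds_trans by blast
        then have "s \<in> S" using h[of s "l + L"] hL[OF s(1)] s(1) by fastforce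
        then show "\<exists>s\<in>S. Z \<preceq> s" using s by blast
      qed
    next
      fix s N assume "s \<in> S"
      then obtain j where "j \<ge> N + L" "s \<preceq> A j" unfolding S_def by blast
      then show "\<exists>j\<ge>N. s \<preceq> A (j + L)" by (intro exI[of _ "j - L"]) auto
    qed (use ordered_sum_shift[OF A(1)] in auto)
    have "S \<subseteq> \<Sigma>" unfolding S_def by blast
    then have "rep (b, S) \<in> ?\<Sigma>" using reg by (intro UnI2 imageI) auto
    then have tl: "finite_sum (\<lambda>Z. \<exists>s\<in>?\<Sigma>. Z \<simeq> s) (\<Union>i. A (i + L))"
      using regular_sum_equimorphic[OF reg rep[OF reg]] by (intro finite_sum_single bexI)
    have hd: "finite_sum (\<lambda>Z. \<exists>s\<in>?\<Sigma>. Z \<simeq> s) (A i)" for i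
      by (rule finite_sum_mono[OF \<Sigma>(3)[OF A(2)]]) blast
    show ?thesis
      by (rule ordered_sum_split[OF A(1) finite_sum_append hd tl])
  qed
  have "finite_sum (\<lambda>Z. \<exists>s\<in>?\<Sigma>. Z \<simeq> s) X" if "finite_rank (Suc n) X" for X
    using that unfolding finite_rank.simps
  proof (induct rule: finite_sum.induct)
    case (Cons A B)
    then have "finite_sum (\<lambda>Z. \<exists>s\<in>?\<Sigma>. Z \<simeq> s) A" using main by auto
    then show ?case by (rule finite_sum_append) (use Cons in auto)
  qed (rule finite_sum.empty)
  moreover have "finite ?\<Sigma>" using fin \<Sigma>(1) by simp
  ultimately show ?case using cod by (intro exI[of _ ?\<Sigma>] conjI ballI allI impI)
qed

lemma finite_rank_coded:
  assumes "\<forall>M\<in>\<M>. infinite M" "finite_rank n X"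
  shows "coded \<M> X"
proof -
  obtain \<Sigma> where \<Sigma>: "\<forall>s\<in>\<Sigma>. coded \<M> s"
    "\<forall>X. finite_rank n X \<longrightarrow> finite_sum (\<lambda>Z. \<exists>s\<in>\<Sigma>. Z \<simeq> s) X"
    using finite_rank_types[of \<M> n, OF assms(1)] by (elim exE conjE) (rule that)
  have "finite_sum (coded \<M>) X"
  proof (rule finite_sum_mono)
    show "finite_sum (\<lambda>Z. \<exists>s\<in>\<Sigma>. Z \<simeq> s) X" using \<Sigma>(2) assms(2) by blast
    fix Z assume "\<exists>s\<in>\<Sigma>. Z \<simeq> s"
    then obtain s where "s \<in> \<Sigma>" "s \<simeq> Z" unfolding equimorphic_def by blast
    then show "coded \<M> Z" using \<Sigma>(1) coded_equimorphic by blast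
  qed
  then show ?thesis by (rule coded_finite_sum)
qed

section \<open>Scattered sets\<close>

lemma finite_chain_has_max:
  assumes "finite S" "S \<noteq> {}" "transp R" "\<And>x y. x \<in> S \<Longrightarrow> y \<in> S \<Longrightarrow> x = y \<or> R x y \<or> R y x"
  shows "\<exists>m\<in>S. \<forall>x\<in>S. x = m \<or> R x m"
  using assms(1,2,4)
proof (induct S rule: finite_ne_induct)
  case (insert a S)
  then obtain m where m: "m \<in> S" "\<forall>x\<in>S. x = m \<or> R x m" by auto
  have "a = m \<or> R a m \<or> R m a" using insert(5)[of a m] m(1) by simp
  then show ?case
  proof (elim disjE)
    assume "R m a"
    then have "\<forall>x\<in>insert a S. x = a \<or> R x a" using m(2) transpD[OF assms(3), of _ m a] by auto
    then show ?thesis by blast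
  qed (use m in auto)
qed simp

text \<open>The forth half of Cantor's back-and-forth argument. \<open>R\<close> need not be total,
  but the values already given to points of \<open>A\<close> form a chain under \<open>R\<close>, so
  the lower ones have a greatest and the upper ones a least member. The claim
  \<open>R a\<^sub>0 (f x)\<close> controls the values even when \<open>A\<close> is a single point
  and nothing is compared.\<close>

lemma countable_chain_into_dense:
  fixes R :: "'b \<Rightarrow> 'b \<Rightarrow> bool" and lt :: "'a \<Rightarrow> 'a \<Rightarrow> bool"
  assumes R: "transp R" "\<And>a b. R a b \<Longrightarrow> \<exists>c. R a c \<and> R c b" "R a\<^sub>0 b\<^sub>0"
    and A: "countable A" and lt_trans: "\<And>x y z. x \<in> A \<Longrightarrow> y \<in> A \<Longrightarrow> z \<in> A \<Longrightarrow> lt x y \<Longrightarrow> lt y z \<Longrightarrow> lt x z"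
    and lt_total: "\<And>x y. x \<in> A \<Longrightarrow> y \<in> A \<Longrightarrow> x \<noteq> y \<Longrightarrow> lt x y \<or> lt y x"
    and lt_irrefl: "\<And>x. x \<in> A \<Longrightarrow> \<not> lt x x"
  shows "\<exists>f. (\<forall>x\<in>A. R a\<^sub>0 (f x)) \<and> (\<forall>x\<in>A. \<forall>y\<in>A. lt x y \<longrightarrow> R (f x) (f y))"
proof -
  define N where "N = to_nat_on A ` A"
  define e where "e = from_nat_into A"
  have e: "e n \<in> A" if "n \<in> N" for n
    using that A unfolding N_def e_def by auto
  have e_eq: "e m = e n \<longleftrightarrow> m = n" if "m \<in> N" "n \<in> N" for m n
    using that A unfolding N_def e_def by auto
  \<comment> \<open>Indices outside \<open>N\<close> belong to no point of \<open>A\<close>; they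
    merely receive some value between the two ends.\<close>
  define P where "P f n r \<longleftrightarrow> R a\<^sub>0 r \<and> R r b\<^sub>0 \<and> (\<forall>m<n. m \<in> N \<longrightarrow> n \<in> N \<longrightarrow>
    (lt (e m) (e n) \<longrightarrow> R (f m) r) \<and> (lt (e n) (e m) \<longrightarrow> R r (f m)))" for f and n :: nat and r
  have "\<exists>f. \<forall>n. P f n (f n)"
  proof (rule dependent_wellorder_choice)
    fix n :: nat and f :: "nat \<Rightarrow> 'b"
    assume IH: "\<And>m. m < n \<Longrightarrow> P f m (f m)"
    have ord: "R (f m) (f m')"
      if "m < n" "m' < n" "m \<in> N" "m' \<in> N" "lt (e m) (e m')" for m m'
    proof -
      have "m \<noteq> m'" using lt_irrefl e that(3,5) by blast
      then consider "m < m'" | "m' < m" by linarith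
      then show ?thesis using IH[OF that(1)] IH[OF that(2)] that(3-5) unfolding P_def by cases blast+
    qed
    have bd: "R a\<^sub>0 (f m)" "R (f m) b\<^sub>0" if "m < n" for m
      using IH[OF that] unfolding P_def by blast+
    show "\<exists>r. P f n r"
    proof (cases "n \<in> N")
      case True
      define Lo where "Lo = insert a\<^sub>0 (f ` {m. m < n \<and> m \<in> N \<and> lt (e m) (e n)})"
      define Up where "Up = insert b\<^sub>0 (f ` {m. m < n \<and> m \<in> N \<and> lt (e n) (e m)})"
      have cmp: "x = y \<or> R x y \<or> R y x" if xy: "x \<in> f ` {m. m < n \<and> m \<in> N \<and> Q m}"
        "y \<in> f ` {m. m < n \<and> m \<in> N \<and> Q m}" for x y Q
      proof -
        obtain m m' where m: "x = f m" "m < n" "m \<in> N" "y = f m'" "m' < n" "m' \<in> N"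
          using xy by blast
        then show ?thesis using ord[of m m'] ord[of m' m] lt_total[OF e[of m] e[of m']] e_eq[of m m']
          by blast
      qed
      have "\<exists>l\<in>Lo. \<forall>x\<in>Lo. x = l \<or> R x l"
      proof (rule finite_chain_has_max[OF _ _ R(1)])
        show "x = y \<or> R x y \<or> R y x" if "x \<in> Lo" "y \<in> Lo" for x y
          using that cmp[of x "\<lambda>m. lt (e m) (e n)" y] bd unfolding Lo_def by blast
      qed (auto simp: Lo_def)
      then obtain l where l: "l \<in> Lo" "\<And>x. x \<in> Lo \<Longrightarrow> x = l \<or> R x l" by blast
      have "\<exists>u\<in>Up. \<forall>x\<in>Up. x = u \<or> R\<inverse>\<inverse> x u"
      proof (rule finite_chain_has_max)
        show "x = y \<or> R\<inverse>\<inverse> x y \<or> R\<inverse>\<inverse> y x" if "x \<in> Up" "y \<in> Up" for x y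
          using that cmp[of x "\<lambda>m. lt (e n) (e m)" y] bd unfolding Up_def by blast
      qed (use R(1) in \<open>auto simp: Up_def transp_def\<close>)
      then obtain u where u: "u \<in> Up" "\<And>x. x \<in> Up \<Longrightarrow> x = u \<or> R u x" by auto
      have "R l u"
      proof -
        have "R (f m) (f m')" if "m < n" "m \<in> N" "lt (e m) (e n)" "m' < n" "m' \<in> N" "lt (e n) (e m')" for m m'
          using ord[OF that(1,4,2,5)] lt_trans[OF e[OF that(2)] e[OF True] e[OF that(5)] that(3,6)] by blast
        then show ?thesis using l(1) u(1) R(3) bd unfolding Lo_def Up_def by blast
      qed
      then obtain r where r: "R l r" "R r u" using R(2) by blast
      have 1: "R x r" if "x \<in> Lo" for x using l(2)[OF that] r(1) transpD[OF R(1)] by blast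
      have 2: "R r x" if "x \<in> Up" for x using u(2)[OF that] r(2) transpD[OF R(1)] by blast
      have "P f n r" unfolding P_def using 1 2 unfolding Lo_def Up_def by blast
      then show ?thesis by blast
    next
      case False
      then show ?thesis using R(2)[OF R(3)] unfolding P_def by blast
    qed
  qed (simp add: P_def)
  then obtain f where f: "\<And>n. P f n (f n)" by blast
  define g where "g x = f (to_nat_on A x)" for x
  have "R (g x) (g y)" if xy: "x \<in> A" "y \<in> A" "lt x y" for x y
  proof -
    let ?m = "to_nat_on A x" and ?n = "to_nat_on A y"
    have N: "?m \<in> N" "?n \<in> N" "e ?m = x" "e ?n = y" using xy A unfolding N_def e_def by auto
    have "x \<noteq> y" using lt_irrefl[OF xy(1)] xy(3) by blast
    then have "?m \<noteq> ?n" using N(3,4) by metis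
    then consider "?m < ?n" | "?n < ?m" by linarith
    then show ?thesis
    proof cases
      case 1
      then show ?thesis using f[of ?n] N xy(3) unfolding P_def g_def by simp
    next
      case 2
      then show ?thesis using f[of ?m] N xy(3) unfolding P_def g_def by simp
    qed
  qed
  moreover have "R a\<^sub>0 (g x)" for x using f unfolding P_def g_def by blast
  ultimately show ?thesis by blast
qed

section \<open>Hausdorff's dichotomy between scattered and universal sets\<close>

inductive scattered :: "rat set \<Rightarrow> bool" where
  empty: "scattered {}"
| singleton: "scattered {x}"
| sum: "(\<And>i::nat. scattered (A i)) \<Longrightarrow> ordered_sum b A \<Longrightarrow> scattered (\<Union>i. A i)"

lemma scattered_subset: "scattered X \<Longrightarrow> Y \<subseteq> X \<Longrightarrow> scattered Y"
proof (induct arbitrary: Y rule: scattered.induct)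
  case (sum A b)
  have "scattered (\<Union>i. A i \<inter> Y)"
    by (rule scattered.sum[of _ b]) (auto intro: sum(2) ordered_sum_mono[OF sum(3)])
  moreover have "(\<Union>i. A i \<inter> Y) = Y" using sum(4) by blast
  ultimately show ?case by simp
qed (auto simp: subset_singleton_iff intro: scattered.intros)

lemma scattered_Un:
  assumes "scattered X" "scattered Y" "before X Y"
  shows "scattered (X \<union> Y)"
proof -
  let ?A = "\<lambda>i::nat. if i = 0 then X else if i = 1 then Y else {}"
  have "scattered (\<Union>i. ?A i)"
    by (rule scattered.sum[of _ True]) (use assms in \<open>auto simp: ordered_sum_def before_def intro: scattered.empty\<close>)
  moreover have "(\<Union>i. ?A i) = X \<union> Y" by (auto split: if_splits)
  ultimately show ?thesis by simp
qed

lemma scattered_uminus: "scattered X \<Longrightarrow> scattered (uminus ` X)"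
proof (induct rule: scattered.induct)
  case (sum A b)
  have "ordered_sum (\<not> b) (\<lambda>i. uminus ` A i)"
    using sum(3) by (auto simp: ordered_sum_def before_def)
  then have "scattered (\<Union>i. uminus ` A i)" by (rule scattered.sum[rotated]) (rule sum(2))
  then show ?case by (simp add: image_UN)
qed (auto intro: scattered.intros)

text \<open>The maxima of longer and longer parts of an enumeration form a nondecreasing cofinal
  sequence. It cuts \<open>X\<close> into a sum along \<omega> of pieces that lie in initial
  segments.\<close>

lemma scattered_initial:
  assumes "\<And>c. c \<in> X \<Longrightarrow> scattered (X \<inter> {..c})"
  shows "scattered X"
proof (cases "X = {}")
  case False
  define e where "e = from_nat_into X"
  have e: "e i \<in> X" for i unfolding e_def by (rule from_nat_into[OF False])
  define m where "m i = Max (e ` {..i})" for i :: nat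
  have mX: "m i \<in> X" for i
  proof -
    have "m i \<in> e ` {..i}" unfolding m_def by (intro Max_in) auto
    then show ?thesis using e by auto
  qed
  \<comment> \<open>A repeated maximum gives an empty piece, which an ordered sum allows.\<close>
  let ?A = "\<lambda>i. {x \<in> X. x \<le> m i \<and> (\<forall>j<i. m j < x)}"
  have "scattered (\<Union>i. ?A i)"
  proof (rule scattered.sum[of _ True])
    show "scattered (?A i)" for i
      using scattered_subset[OF assms[OF mX[of i]], of "?A i"] by blast
    show "ordered_sum True ?A"
      unfolding ordered_sum_def before_def by (auto intro: le_less_trans)
  qed
  moreover have "x \<in> (\<Union>i. ?A i)" if x: "x \<in> X" for x
  proof -
    have "x = e (to_nat_on X x)" unfolding e_def using x by simp
    then have "x \<le> m (to_nat_on X x)" unfolding m_def by (intro Max_ge) auto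
    then have "x \<le> m (LEAST i. x \<le> m i)" by (rule LeastI)
    moreover have "\<forall>j<(LEAST i. x \<le> m i). m j < x" using not_less_Least not_le by blast
    ultimately show ?thesis using x by blast
  qed
  then have "(\<Union>i. ?A i) = X" by blast
  ultimately show ?thesis by simp
qed (simp add: scattered.empty)

lemma scattered_final:
  assumes "\<And>c. c \<in> X \<Longrightarrow> scattered (X \<inter> {c..})"
  shows "scattered X"
proof -
  have "scattered (uminus ` X)"
  proof (rule scattered_initial)
    fix c assume c: "c \<in> uminus ` X"
    then have "scattered (uminus ` (X \<inter> {-c..}))" by (intro scattered_uminus assms) auto
    moreover have "uminus ` (X \<inter> {-c..}) = uminus ` X \<inter> {..c}" by force
    ultimately show "scattered (uminus ` X \<inter> {..c})" by simp
  qed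
  from scattered_uminus[OF this] show ?thesis by (simp add: image_image)
qed

text \<open>Hausdorff's condensation: the relation \<open>R a b\<close> says that the part of
  \<open>X\<close> between \<open>a\<close> and \<open>b\<close> is not scattered. It is nonempty,
  since otherwise \<open>X\<close> would be scattered, and dense, so any countable chain can be
  mapped into it.\<close>

theorem not_scattered_universal:
  assumes "\<not> scattered X"
  shows "Y \<preceq> X"
proof -
  define R where "R a b \<longleftrightarrow> a \<in> X \<and> b \<in> X \<and> a < b \<and> \<not> scattered (X \<inter> {a..b})" for a b
  have self: "scattered (X \<inter> {a..a})" for a
    by (rule scattered_subset[OF scattered.singleton[of a]]) auto
  have "transp R"
  proof (rule transpI)
    fix a b c assume "R a b" "R b c"
    moreover from this have "X \<inter> {a..b} \<subseteq> X \<inter> {a..c}" unfolding R_def by auto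
    ultimately show "R a c" unfolding R_def
      using scattered_subset[of "X \<inter> {a..c}" "X \<inter> {a..b}"] by auto
  qed
  have ex: "\<exists>a b. R a b"
  proof (rule ccontr)
    assume "\<not> (\<exists>a b. R a b)"
    then have sc: "scattered (X \<inter> {a..b})" if "a \<in> X" "b \<in> X" for a b
      using that self[of a] scattered.empty unfolding R_def
      by (cases a b rule: linorder_cases) auto
    obtain a where a: "a \<in> X" using assms scattered.empty by fastforce
    have "scattered (X \<inter> {a..})"
    proof (rule scattered_initial)
      fix c assume "c \<in> X \<inter> {a..}"
      then have "scattered (X \<inter> {a..c})" using sc a by blast
      then show "scattered (X \<inter> {a..} \<inter> {..c})" by (rule scattered_subset) auto
    qed
    moreover have "scattered (X \<inter> {..<a})"
    proof (rule scattered_final)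
      fix c assume "c \<in> X \<inter> {..<a}"
      then have "scattered (X \<inter> {c..a})" using sc a by blast
      then show "scattered (X \<inter> {..<a} \<inter> {c..})" by (rule scattered_subset) auto
    qed
    moreover have "X = X \<inter> {..<a} \<union> X \<inter> {a..}" by auto
    moreover have "before (X \<inter> {..<a}) (X \<inter> {a..})" unfolding before_def by auto
    ultimately show False using scattered_Un assms by metis
  qed
  have dense: "\<exists>c. R a c \<and> R c b" if ab: "R a b" for a b
  proof (rule ccontr)
    assume no: "\<not> (\<exists>c. R a c \<and> R c b)"
    \<comment> \<open>If there were no intermediate point, every \<open>c\<close> would have a
      scattered interval to \<open>a\<close> or to \<open>b\<close>. The lower part is exhausted by
      scattered initial segments and the upper part by scattered final segments, so the whole
      interval would be scattered.\<close>
    let ?L = "{c \<in> X \<inter> {a..b}. scattered (X \<inter> {a..c})}"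
    let ?U = "{c \<in> X \<inter> {a..b}. \<not> scattered (X \<inter> {a..c})}"
    have "scattered ?L"
    proof (rule scattered_initial)
      fix c assume "c \<in> ?L"
      then have "scattered (X \<inter> {a..c})" by blast
      then show "scattered (?L \<inter> {..c})" by (rule scattered_subset) auto
    qed
    moreover have "scattered ?U"
    proof (rule scattered_final)
      fix c assume c: "c \<in> ?U"
      then have "c \<noteq> a" using scattered.singleton[of a] by auto
      then have "R a c" using c ab unfolding R_def by auto
      then have "\<not> R c b" using no by blast
      then have "scattered (X \<inter> {c..b})"
        using c ab self[of b] unfolding R_def by (cases "c = b") auto
      then show "scattered (?U \<inter> {c..})" by (rule scattered_subset) auto
    qed
    moreover have "before ?L ?U"
      unfolding before_def
    proof (intro ballI, rule ccontr)
      fix l u assume lu: "l \<in> ?L" "u \<in> ?U" "\<not> l < u"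
      then have "X \<inter> {a..u} \<subseteq> X \<inter> {a..l}" by auto
      then have "scattered (X \<inter> {a..u})" using scattered_subset lu(1) by blast
      then show False using lu(2) by blast
    qed
    ultimately have "scattered (?L \<union> ?U)" by (rule scattered_Un)
    moreover have "?L \<union> ?U = X \<inter> {a..b}" by blast
    ultimately show False using ab unfolding R_def by simp
  qed
  obtain a b where "R a b" using ex by blast
  have "\<exists>f. (\<forall>x\<in>Y. R a (f x)) \<and> (\<forall>x\<in>Y. \<forall>y\<in>Y. x < y \<longrightarrow> R (f x) (f y))"
    by (rule countable_chain_into_dense[OF \<open>transp R\<close> dense \<open>R a b\<close>]) auto
  then obtain f where f: "\<forall>x\<in>Y. R a (f x)" "\<forall>x\<in>Y. \<forall>y\<in>Y. x < y \<longrightarrow> R (f x) (f y)"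
    by blast
  show ?thesis
    by (rule embedsI[of _ f]) (use f in \<open>auto simp: R_def\<close>)
qed

section \<open>Scattered sets with finite big Ramsey degrees\<close>

text \<open>With \<open>L\<close> read as the branches of a tree, this asks for a subtree below
  \<open>s\<close> with \<open>n\<close> levels of infinite branching. The stretch \<open>t\<close>
  allows the next branching to occur at any depth.\<close>

fun rich :: "nat \<Rightarrow> nat list set \<Rightarrow> nat list \<Rightarrow> bool" where
  "rich 0 L s \<longleftrightarrow> (\<exists>t. s @ t \<in> L)"
| "rich (Suc n) L s \<longleftrightarrow> (\<exists>t. infinite {c. rich n L (s @ t @ [c])})"

lemma rich_Suc: "rich (Suc n) L s \<Longrightarrow> rich n L s"
proof (induct n arbitrary: s)
  case 0
  then obtain t where "infinite {c. rich 0 L (s @ t @ [c])}" by auto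
  then obtain c where "rich 0 L (s @ t @ [c])" using infinite_imp_nonempty by blast
  then show ?case by auto
next
  case (Suc n)
  from Suc(2) obtain t where "infinite {c. rich (Suc n) L (s @ t @ [c])}"
    unfolding rich.simps(2)[of "Suc n"] by blast
  moreover have "{c. rich (Suc n) L (s @ t @ [c])} \<subseteq> {c. rich n L (s @ t @ [c])}"
    using Suc(1) by blast
  ultimately have "infinite {c. rich n L (s @ t @ [c])}" using infinite_super by blast
  then show ?case unfolding rich.simps by blast
qed

text \<open>The shift of labels is injective, so infinitely many children remain infinitely many
  when a summand is hung below the root.\<close>

lemma rich_shift:
  assumes "rich n L' s" "\<And>l. l \<in> L' \<Longrightarrow> i # map (\<lambda>m. m + Suc i) l \<in> L"
  shows "rich n L (i # map (\<lambda>m. m + Suc i) s)"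
  using assms(1)
proof (induct n arbitrary: s)
  case 0
  then obtain t where "s @ t \<in> L'" by auto
  then have "(i # map (\<lambda>m. m + Suc i) s) @ map (\<lambda>m. m + Suc i) t \<in> L" using assms(2) by fastforce
  then show ?case unfolding rich.simps by blast
next
  case (Suc n)
  let ?g = "\<lambda>m. m + Suc i"
  obtain t where "infinite {c. rich n L' (s @ t @ [c])}" using Suc(2) by auto
  then have "infinite (?g ` {c. rich n L' (s @ t @ [c])})" by (subst finite_image_iff) (auto simp: inj_on_def)
  moreover have "?g ` {c. rich n L' (s @ t @ [c])} \<subseteq> {c. rich n L ((i # map ?g s) @ map ?g t @ [c])}"
    using Suc(1)[of "s @ t @ [_]"] by auto
  ultimately have "infinite {c. rich n L ((i # map ?g s) @ map ?g t @ [c])}" using infinite_super by blast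
  then show ?case unfolding rich.simps by blast
qed

text \<open>A scattered set is the set of leaves of a well-founded tree; \<open>P\<close> assigns to a point the path
  leading to it.\<close>

lemma scattered_path:
  assumes "scattered X"
  shows "\<exists>P. (\<forall>x\<in>X. sorted_wrt (<) (P x)) \<and>
    (\<forall>n Y. Y \<subseteq> X \<longrightarrow> \<not> finite_rank n Y \<longrightarrow> rich n (P ` Y) [])"
  using assms
proof (induct rule: scattered.induct)
  case empty
  show ?case using finite_rank_empty by auto
next
  case (singleton x)
  show ?case by (rule exI[of _ "\<lambda>_. []"]) (use finite_rank_subsingleton in auto)
next
  case (sum A b)
  from sum(2) obtain Q where Q: "\<And>i x. x \<in> A i \<Longrightarrow> sorted_wrt (<) (Q i x)"
    "\<And>i n Y. Y \<subseteq> A i \<Longrightarrow> \<not> finite_rank n Y \<Longrightarrow> rich n (Q i ` Y) []" by metis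
  define idx where "idx x = (SOME i. x \<in> A i)" for x
  have idx: "idx x = i" if "x \<in> A i" for x i
    unfolding idx_def by (rule some_equality) (use that ordered_sum_disjoint[OF sum(3)] in auto)
  \<comment> \<open>Adding \<open>Suc (idx x)\<close> to all later labels makes every path strictly
    increasing, so labels of different depths and of different paths can be interleaved as natural
    numbers.\<close>
  define P where "P x = idx x # map (\<lambda>m. m + Suc (idx x)) (Q (idx x) x)" for x
  have P: "P x = i # map (\<lambda>m. m + Suc i) (Q i x)" if "x \<in> A i" for x i
    unfolding P_def idx[OF that] ..
  show ?case
  proof (intro exI[of _ P] conjI ballI allI impI)
    fix x assume "x \<in> (\<Union>i. A i)"
    then obtain i where "x \<in> A i" by blast
    then show "sorted_wrt (<) (P x)" using Q(1)[of x i] by (simp add: P sorted_wrt_map)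
  next
    fix n Y assume Y: "Y \<subseteq> (\<Union>i. A i)" "\<not> finite_rank n Y"
    have lift: "rich m (P ` Y) [i]" if "\<not> finite_rank m (A i \<inter> Y)" for m i
      using rich_shift[OF Q(2)[OF _ that], where i = i and L = "P ` Y"] by (force simp: P)
    show "rich n (P ` Y) []"
    proof (cases n)
      case 0
      then have "Y \<noteq> {}" using Y(2) by auto
      then show ?thesis using 0 by auto
    next
      case (Suc k)
      have os: "ordered_sum b (\<lambda>i. A i \<inter> Y)" by (rule ordered_sum_mono[OF sum(3)]) auto
      have eq: "(\<Union>i. A i \<inter> Y) = Y" using Y(1) by blast
      \<comment> \<open>Either all summands have level \<open>n\<close>, and then infinitely many
        fail level \<open>k\<close>, so the root itself branches; or some summand already fails
        level \<open>n\<close>, and its richness passes to the root.\<close>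
      show ?thesis
      proof (cases "\<forall>i. finite_rank n (A i \<inter> Y)")
        case True
        then have "infinite {i. \<not> finite_rank k (A i \<inter> Y)}"
          using finite_rank_cofinite[OF os, of k] Y(2) eq Suc by auto
        moreover have "{i. \<not> finite_rank k (A i \<inter> Y)} \<subseteq> {c. rich k (P ` Y) ([] @ [] @ [c])}"
          using lift by auto
        ultimately have "infinite {c. rich k (P ` Y) ([] @ [] @ [c])}" using infinite_super by blast
        then show ?thesis unfolding Suc rich.simps by blast
      next
        case False
        then obtain i where "rich n (P ` Y) [i]" using lift by blast
        then obtain t where "infinite {c. rich k (P ` Y) ([i] @ t @ [c])}" unfolding Suc rich.simps by blast
        then have "infinite {c. rich k (P ` Y) ([] @ ([i] @ t) @ [c])}" by simp
        then show ?thesis unfolding Suc rich.simps by blast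
      qed
    qed
  qed
qed

section \<open>Alternations between two increasing paths\<close>

definition blocks :: "nat list \<Rightarrow> nat list \<Rightarrow> nat" where
  "blocks x y = length (remdups_adj (map (\<lambda>z. (z \<in> set x, z \<in> set y)) (sorted_list_of_set (set x \<union> set y))))"

text \<open>\<open>blocks\<close> counts the runs when the labels of two paths are merged in
  increasing order; the common initial part is dropped so that only the parts after the splitting
  node are merged. The value 0 for a path and its prefix, in particular for equal paths, is distinct
  from the values \<open>j + 2\<close> used below.\<close>

fun alternation :: "nat list \<Rightarrow> nat list \<Rightarrow> nat" where
  "alternation (a # x) (b # y) = (if a = b then alternation x y else blocks (a # x) (b # y))"
| "alternation _ _ = 0"

lemma blocks_commute: "blocks x y = blocks y x"
proof -
  have "map (\<lambda>z. (z \<in> set x, z \<in> set y)) l = map prod.swap (map (\<lambda>z. (z \<in> set y, z \<in> set x)) l)" for l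
    by simp
  then show ?thesis
    unfolding blocks_def by (simp add: Un_commute remdups_adj_map_injective del: map_map)
qed

lemma alternation_commute: "alternation x y = alternation y x"
  by (induct x y rule: alternation.induct) (auto simp: blocks_commute)

lemma alternation_append: "alternation (s @ x) (s @ y) = alternation x y"
  by (induct s) auto

lemma sorted_list_of_set_Un_less:
  fixes A B :: "nat set"
  assumes "finite A" "finite B" "\<And>a b. a \<in> A \<Longrightarrow> b \<in> B \<Longrightarrow> a < b"
  shows "sorted_list_of_set (A \<union> B) = sorted_list_of_set A @ sorted_list_of_set B"
proof -
  have "A \<inter> B = {}" using assms(3) by blast
  then have "sorted (sorted_list_of_set A @ sorted_list_of_set B)"
    "distinct (sorted_list_of_set A @ sorted_list_of_set B)"
    "set (sorted_list_of_set A @ sorted_list_of_set B) = A \<union> B"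
    using assms by (auto simp: sorted_append less_imp_le)
  then show ?thesis using sorted_list_of_set.idem_if_sorted_distinct by metis
qed

lemma remdups_adj_prefix:
  assumes "xs \<noteq> []" "\<And>z. z \<in> set xs \<Longrightarrow> z = p" "ys \<noteq> []" "hd ys \<noteq> p"
  shows "remdups_adj (xs @ ys) = p # remdups_adj ys"
  using assms(1,2)
proof (induct xs)
  case (Cons a xs)
  then show ?case using assms(3,4) by (cases xs; cases ys) auto
qed simp

text \<open>All of \<open>w\<close> precedes \<open>d\<close>, and \<open>d\<close> belongs to the
  other path, so the merged list gains exactly one run at its front.\<close>

lemma blocks_Cons_block:
  assumes "w \<noteq> []" "sorted_wrt (<) (d # x)" "\<And>a. a \<in> set w \<Longrightarrow> a < d" "\<And>a. a \<in> set y \<Longrightarrow> d < a"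
  shows "blocks (d # x) (w @ y) = Suc (blocks (d # x) y)"
proof -
  let ?V = "set (d # x) \<union> set y"
  let ?l = "\<lambda>z. (z \<in> set (d # x), z \<in> set (w @ y))"
  let ?s = "sorted_list_of_set ?V"
  have less: "a < b" if "a \<in> set w" "b \<in> ?V" for a b
    using that assms(2,3,4) by (auto intro: less_trans)
  have split: "sorted_list_of_set (set (d # x) \<union> set (w @ y)) = sorted_list_of_set (set w) @ ?s"
    using sorted_list_of_set_Un_less[of "set w" ?V] less by (simp add: Un_left_commute Un_assoc insert_def[symmetric] Un_commute)
  have V: "?s = d # sorted_list_of_set (?V - {d})"
  proof -
    have "Min ?V = d" by (rule Min_eqI) (use assms(2,4) in \<open>auto intro: less_imp_le\<close>)
    then show ?thesis using sorted_list_of_set_nonempty[of ?V] by simp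
  qed
  have "remdups_adj (map ?l (sorted_list_of_set (set w)) @ map ?l ?s) = (False, True) # remdups_adj (map ?l ?s)"
  proof (rule remdups_adj_prefix)
    show "map ?l (sorted_list_of_set (set w)) \<noteq> []" using assms(1) by (simp add: sorted_list_of_set_eq_Nil_iff)
    show "z = (False, True)" if "z \<in> set (map ?l (sorted_list_of_set (set w)))" for z
      using that less by fastforce
    show "hd (map ?l ?s) \<noteq> (False, True)" unfolding V by simp
  qed (simp add: V)
  moreover have "map ?l ?s = map (\<lambda>z. (z \<in> set (d # x), z \<in> set y)) ?s"
  proof (rule map_cong[OF refl])
    fix z assume "z \<in> set ?s"
    then have "z \<in> ?V" by (subst (asm) set_sorted_list_of_set) auto
    then have "z \<notin> set w" using less[of z z] by blast
    then show "?l z = (z \<in> set (d # x), z \<in> set y)" by simp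
  qed
  ultimately show ?thesis unfolding blocks_def split by (simp only: map_append length_Cons)
qed

lemma blocks_Nil: "blocks (d # x) [] = 1"
proof -
  define s where "s = sorted_list_of_set (set (d # x) \<union> set [])"
  have s: "set s = set (d # x)" unfolding s_def by (subst set_sorted_list_of_set) auto
  have "map (\<lambda>z. (z \<in> set (d # x), z \<in> set [])) s = replicate (length s) (True, False)"
    by (rule replicate_eqI) (use s in auto)
  moreover have "length s \<noteq> 0" using s by auto
  ultimately show ?thesis unfolding blocks_def s_def[symmetric] by (simp add: remdups_adj_replicate)
qed

text \<open>The two paths are extended in turn, each time by a child beyond everything chosen so far.\<close>

lemma alternating_pair:
  assumes "L \<subseteq> {l. sorted_wrt (<) l}"
    and "infinite {d. rich j L (u @ [d])}" "rich j L (v @ [c])"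
  shows "\<exists>x y. u @ x \<in> L \<and> v @ c # y \<in> L \<and> x \<noteq> [] \<and> (\<forall>a\<in>set x. c < a) \<and> blocks x (c # y) = j + 2"
  using assms(2,3)
proof (induct j arbitrary: u v c)
  case 0
  then obtain y where y: "v @ c # y \<in> L" by auto
  obtain d where d: "d > Max (set (c # y))" "rich 0 L (u @ [d])"
    using 0(1) unfolding infinite_nat_iff_unbounded mem_Collect_eq by blast
  then obtain x where x: "u @ d # x \<in> L" by auto
  have d': "a < d" if "a \<in> set (c # y)" for a using that d(1) by (meson List.finite_set Max_ge le_less_trans)
  have sd: "sorted_wrt (<) (d # x)" using x assms(1) by (auto simp: sorted_wrt_append)
  have "blocks (d # x) ((c # y) @ []) = Suc (blocks (d # x) [])"
    by (rule blocks_Cons_block) (use sd d' in auto)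
  moreover have "\<forall>a\<in>set (d # x). c < a" using sd d'[of c] by (auto intro: less_trans)
  ultimately show ?case using x y by (intro exI[of _ "d # x"] exI[of _ y]) (simp add: blocks_Nil)
next
  case (Suc j)
  obtain s where s: "infinite {e. rich j L ((v @ c # s) @ [e])}" using Suc(3) by auto
  obtain d where d: "d > Max (set (c # s))" "rich (Suc j) L (u @ [d])"
    using Suc(2) unfolding infinite_nat_iff_unbounded mem_Collect_eq by blast
  have d': "a < d" if "a \<in> set (c # s)" for a using that d(1) by (meson List.finite_set Max_ge le_less_trans)
  \<comment> \<open>The two paths exchange roles: the next infinitely branching node lies on the
    path through \<open>c\<close>, and \<open>d\<close> now plays the part of \<open>c\<close>. By
    \<open>rich_Suc\<close> the child \<open>d\<close> is rich enough for the smaller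
    \<open>j\<close>. The segment \<open>c # s\<close>, all below \<open>d\<close>, then becomes the
    additional run.\<close>
  obtain x y where xy: "(v @ c # s) @ x \<in> L" "u @ d # y \<in> L" "\<forall>a\<in>set x. d < a" "blocks x (d # y) = j + 2"
    using Suc(1)[OF s rich_Suc[OF d(2)]] by blast
  have sd: "sorted_wrt (<) (d # y)" using xy(2) assms(1) by (auto simp: sorted_wrt_append)
  have "blocks (d # y) ((c # s) @ x) = Suc (blocks (d # y) x)"
    by (rule blocks_Cons_block) (use sd d' xy(3) in auto)
  then have "blocks (d # y) (c # s @ x) = Suc j + 2" using xy(4) by (simp add: blocks_commute)
  moreover have "\<forall>a\<in>set (d # y). c < a" using sd d'[of c] by (auto intro: less_trans)
  ultimately show ?case using xy by (intro exI[of _ "d # y"] exI[of _ "s @ x"]) simp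
qed

text \<open>Both paths are grown from the same branching node. As all entries of \<open>x\<close>
  exceed \<open>c\<close>, they separate exactly there, and \<open>alternation\<close> strips
  nothing but \<open>s\<close>.\<close>

lemma rich_alternation:
  assumes "L \<subseteq> {l. sorted_wrt (<) l}" "rich (Suc j) L []"
  shows "\<exists>l\<in>L. \<exists>l'\<in>L. alternation l l' = j + 2"
proof -
  obtain s where s: "infinite {c. rich j L (s @ [c])}" using assms(2) by auto
  then obtain c where "rich j L (s @ [c])" using infinite_imp_nonempty by blast
  from alternating_pair[OF assms(1) s this] obtain x y where
    xy: "s @ x \<in> L" "s @ c # y \<in> L" "x \<noteq> []" "\<forall>a\<in>set x. c < a" "blocks x (c # y) = j + 2" by blast
  have "alternation (s @ x) (s @ c # y) = j + 2"
    using xy(3-5) unfolding alternation_append by (cases x) auto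
  then show ?thesis using xy(1,2) by blast
qed

text \<open>An embedding of a finite chain is determined by its image, so sets of size
  \<open>n\<close> replace embeddings; for \<open>n \<ge> 1\<close> the condition on
  \<open>card\<close> also forces them to be finite. The bound \<open>t\<close> precedes the
  colouring and so cannot depend on the number of colours.\<close>

definition finite_degrees :: "rat set \<Rightarrow> bool" where
  "finite_degrees X \<longleftrightarrow> (\<forall>n\<ge>1. \<exists>t. \<forall>\<chi>::rat set \<Rightarrow> nat. finite (range \<chi>) \<longrightarrow>
    (\<exists>w. strict_mono_on X w \<and> w ` X \<subseteq> X \<and> card (\<chi> ` {S. S \<subseteq> w ` X \<and> card S = n}) \<le> t))"

text \<open>The \<open>t + 1\<close> colours from 2 to \<open>t + 2\<close> cannot all survive on a
  copy with at most \<open>t\<close> colours. A copy that omits \<open>j + 2\<close> has rank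
  \<open>Suc j\<close>, because otherwise \<open>rich_alternation\<close> would produce a pair of
  that colour.\<close>

theorem scattered_finite_rank:
  assumes "scattered X" "finite_degrees X"
  shows "\<exists>n Y. finite_rank n Y \<and> X \<simeq> Y"
proof -
  obtain P where P: "\<And>x. x \<in> X \<Longrightarrow> sorted_wrt (<) (P x)"
    "\<And>n Y. Y \<subseteq> X \<Longrightarrow> \<not> finite_rank n Y \<Longrightarrow> rich n (P ` Y) []"
    using scattered_path[OF assms(1)] by blast
  obtain t where t: "\<And>\<chi>::rat set \<Rightarrow> nat. finite (range \<chi>) \<Longrightarrow>
    \<exists>w. strict_mono_on X w \<and> w ` X \<subseteq> X \<and> card (\<chi> ` {S. S \<subseteq> w ` X \<and> card S = 2}) \<le> t"
    using assms(2) unfolding finite_degrees_def by (metis one_le_numeral)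
  \<comment> \<open>Truncation leaves finitely many colours and does not affect the values up to
    \<open>t + 2\<close>, except that larger ones are merged into the last; for the missing colour
    only the direction from alternation to colour is used.\<close>
  define \<chi> where "\<chi> S = min (alternation (P (Min S)) (P (Max S))) (t + 2)" for S
  have "range \<chi> \<subseteq> {..t + 2}" unfolding \<chi>_def by auto
  then have "finite (range \<chi>)" by (rule finite_subset) simp
  then obtain w where w: "strict_mono_on X w" "w ` X \<subseteq> X"
    "card (\<chi> ` {S. S \<subseteq> w ` X \<and> card S = 2}) \<le> t" using t by blast
  let ?Y = "w ` X" and ?C = "\<chi> ` {S. S \<subseteq> w ` X \<and> card S = 2}"
  have "X \<simeq> ?Y"
    unfolding equimorphic_def using w(1) embeds_subset[OF w(2)] by (auto simp: embeds_def)
  have "\<not> (\<lambda>j. j + 2) ` {..t} \<subseteq> ?C"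
  proof
    assume "(\<lambda>j. j + 2) ` {..t} \<subseteq> ?C"
    moreover have "finite ?C" by (rule finite_subset[OF _ \<open>finite (range \<chi>)\<close>]) auto
    ultimately have "card ((\<lambda>j. j + 2) ` {..t}) \<le> card ?C" by (simp add: card_mono)
    also have "card ((\<lambda>j. j + 2) ` {..t}) = Suc t" by (subst card_image) (auto simp: inj_on_def)
    finally show False using w(3) by simp
  qed
  then obtain j where j: "j \<le> t" "j + 2 \<notin> ?C" by blast
  have "finite_rank (Suc j) ?Y"
  proof (rule ccontr)
    assume "\<not> finite_rank (Suc j) ?Y"
    then have "rich (Suc j) (P ` ?Y) []" using P(2) w(2) by blast
    moreover have "P ` ?Y \<subseteq> {l. sorted_wrt (<) l}" using P(1) w(2) by blast
    ultimately obtain x y where xy: "x \<in> ?Y" "y \<in> ?Y" "alternation (P x) (P y) = j + 2"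
      using rich_alternation[of "P ` ?Y" j] by (elim meta_impE bexE imageE) auto
    have "x \<noteq> y"
    proof
      assume "x = y"
      then have "alternation (P x) (P y) = 0" using alternation_append[of "P x" "[]" "[]"] by simp
      then show False using xy(3) by simp
    qed
    then have "card {x, y} = 2" by simp
    moreover have "alternation (P (Min {x, y})) (P (Max {x, y})) = j + 2"
      using xy(3) alternation_commute by (cases "x \<le> y") (auto simp: min_def max_def)
    then have "\<chi> {x, y} = j + 2" unfolding \<chi>_def using j(1) by simp
    ultimately show False using j(2) xy(1,2) by (metis (mono_tags, lifting) empty_subsetI imageI insert_subset mem_Collect_eq)
  qed
  then show ?thesis using \<open>X \<simeq> ?Y\<close> by blast
qed

section \<open>Products\<close>

definition ramsey_family :: "nat set set \<Rightarrow> bool" where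
  "ramsey_family \<M> \<longleftrightarrow> (\<forall>M\<in>\<M>. infinite M) \<and>
    (\<forall>m\<ge>1. \<exists>t. \<forall>\<chi>::nat set \<Rightarrow> nat. finite (range \<chi>) \<longrightarrow>
      (\<exists>M\<in>\<M>. card (\<chi> ` {S. S \<subseteq> M \<and> card S = m}) \<le> t))"

lemma ramsey_family_infinite_sets: "ramsey_family {M. infinite M}"
  unfolding ramsey_family_def
proof (intro conjI allI impI exI[of _ 1])
  fix m :: nat and \<chi> :: "nat set \<Rightarrow> nat"
  assume m: "m \<ge> 1" and fin: "finite (range \<chi>)"
  obtain k where k: "\<And>S. \<chi> S < k"
    using fin unfolding finite_nat_set_iff_bounded by blast
  obtain Y c where Y: "infinite Y" "\<And>S. S \<subseteq> Y \<Longrightarrow> finite S \<Longrightarrow> card S = m \<Longrightarrow> \<chi> S = c"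
    using Ramsey[of "UNIV :: nat set" m \<chi> k] k by auto
  have "\<chi> ` {S. S \<subseteq> Y \<and> card S = m} \<subseteq> {c}"
  proof
    fix z assume "z \<in> \<chi> ` {S. S \<subseteq> Y \<and> card S = m}"
    then obtain S where S: "S \<subseteq> Y" "card S = m" "z = \<chi> S" by blast
    then have "finite S" using m card_gt_0_iff[of S] by linarith
    then show "z \<in> {c}" using Y(2) S by blast
  qed
  then have "card (\<chi> ` {S. S \<subseteq> Y \<and> card S = m}) \<le> card {c}" by (intro card_mono) auto
  then show "\<exists>M\<in>{M. infinite M}. card (\<chi> ` {S. S \<subseteq> M \<and> card S = m}) \<le> 1"
    using Y(1) by auto
qed auto

definition copies :: "rat set \<Rightarrow> nat set set" where
  "copies X = {to_nat_on X ` w ` X | w. strict_mono_on X w \<and> w ` X \<subseteq> X}"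

lemma ramsey_family_copies:
  assumes "finite_degrees X" "infinite X"
  shows "ramsey_family (copies X)"
  unfolding ramsey_family_def
proof (intro conjI allI impI ballI)
  fix M assume "M \<in> copies X"
  then obtain w where w: "M = to_nat_on X ` w ` X" "strict_mono_on X w" "w ` X \<subseteq> X"
    unfolding copies_def by blast
  have "inj_on w X" using w(2) by (rule strict_mono_on_imp_inj_on)
  moreover have "inj_on (to_nat_on X) (w ` X)"
    by (rule inj_on_subset[OF inj_on_to_nat_on w(3)]) auto
  ultimately show "infinite M" unfolding w(1) using assms(2) by (simp add: finite_image_iff)
next
  fix m :: nat assume "m \<ge> 1"
  then obtain t where t: "\<And>\<chi>::rat set \<Rightarrow> nat. finite (range \<chi>) \<Longrightarrow>
    \<exists>w. strict_mono_on X w \<and> w ` X \<subseteq> X \<and> card (\<chi> ` {S. S \<subseteq> w ` X \<and> card S = m}) \<le> t"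
    using assms(1) unfolding finite_degrees_def by blast
  have "\<exists>M\<in>copies X. card (\<chi> ` {S. S \<subseteq> M \<and> card S = m}) \<le> t"
    if fin: "finite (range \<chi>)" for \<chi> :: "nat set \<Rightarrow> nat"
  proof -
    let ?e = "to_nat_on X"
    let ?\<chi> = "\<lambda>S. \<chi> (?e ` S)"
    have fin': "finite (range ?\<chi>)" by (rule finite_subset[OF _ fin]) auto
    obtain w where w: "strict_mono_on X w" "w ` X \<subseteq> X" "card (?\<chi> ` {S. S \<subseteq> w ` X \<and> card S = m}) \<le> t"
      using t[OF fin'] by blast
    have le: "\<chi> ` {S. S \<subseteq> ?e ` w ` X \<and> card S = m} \<subseteq> ?\<chi> ` {S. S \<subseteq> w ` X \<and> card S = m}"
    proof
      fix z assume "z \<in> \<chi> ` {S. S \<subseteq> ?e ` w ` X \<and> card S = m}"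
      then obtain S where S: "S \<subseteq> ?e ` w ` X" "card S = m" "z = \<chi> S" by blast
      obtain T where T: "T \<subseteq> w ` X" "S = ?e ` T" using subset_imageE[OF S(1)] by metis
      have "inj_on ?e T" by (rule inj_on_subset[OF inj_on_to_nat_on]) (use T(1) w(2) in auto)
      then have "card T = m" using S(2) T(2) by (simp add: card_image)
      then show "z \<in> ?\<chi> ` {S. S \<subseteq> w ` X \<and> card S = m}" using T S(3) by blast
    qed
    have "finite (?\<chi> ` {S. S \<subseteq> w ` X \<and> card S = m})"
      by (rule finite_subset[OF _ fin']) auto
    from order_trans[OF card_mono[OF this le] w(3)]
    have "card (\<chi> ` {S. S \<subseteq> ?e ` w ` X \<and> card S = m}) \<le> t" .
    moreover have "?e ` w ` X \<in> copies X" unfolding copies_def using w(1,2) by blast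
    ultimately show ?thesis by blast
  qed
  then show "\<exists>t. \<forall>\<chi>::nat set \<Rightarrow> nat. finite (range \<chi>) \<longrightarrow>
      (\<exists>M\<in>copies X. card (\<chi> ` {S. S \<subseteq> M \<and> card S = m}) \<le> t)" by blast
qed

text \<open>Each point is coded by the singleton of its index, hence codes of size 1 suffice and a
  set of naturals codes at most as many points as it has elements.\<close>

lemma coded_copies: "coded (copies X) X"
proof (rule codedI)
  let ?pts = "\<lambda>S. from_nat_into X ` S"
  fix M assume "M \<in> copies X"
  then obtain w where w: "M = to_nat_on X ` w ` X" "strict_mono_on X w" "w ` X \<subseteq> X"
    unfolding copies_def by blast
  show "X \<preceq> X \<inter> coded_points ?pts 1 M"
  proof (rule embedsI)
    show "w x < w y" if "x \<in> X" "y \<in> X" "x < y" for x y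
      using strict_mono_onD[OF w(2)] that by blast
    fix x assume x: "x \<in> X"
    then have "w x \<in> X" using w(3) by blast
    moreover have "w x \<in> coded_points ?pts 1 M"
    proof (rule coded_pointsI)
      show "w x \<in> ?pts {to_nat_on X (w x)}" using \<open>w x \<in> X\<close> by simp
    qed (use x in \<open>auto simp: w(1)\<close>)
    ultimately show "w x \<in> X \<inter> coded_points ?pts 1 M" by blast
  qed
next
  show "card (from_nat_into X ` S) \<le> id (card S)" if "finite S" for S
    using that by (simp add: card_image_le)
qed (auto intro: finite_imageI)

text \<open>Any two sets that are not scattered embed in each other, so the copies of one of them
  serve for all. The scattered sets impose no choice: they are coded over every family of infinite
  sets.\<close>

lemma common_ramsey_family:
  assumes "\<And>i. i \<in> I \<Longrightarrow> finite_degrees (X i)"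
  shows "\<exists>\<M>. ramsey_family \<M> \<and> (\<forall>i\<in>I. coded \<M> (X i))"
proof -
  have scat: "coded \<M> (X i)" if fam: "ramsey_family \<M>" and i: "i \<in> I" "scattered (X i)" for \<M> i
  proof -
    obtain n Y where Y: "finite_rank n Y" "X i \<simeq> Y"
      using scattered_finite_rank[OF i(2) assms[OF i(1)]] by blast
    have "coded \<M> Y"
      using finite_rank_coded[OF _ Y(1)] fam unfolding ramsey_family_def by blast
    moreover have "Y \<simeq> X i" using Y(2) unfolding equimorphic_def by blast
    ultimately show ?thesis by (rule coded_equimorphic)
  qed
  show ?thesis
  proof (cases "\<forall>i\<in>I. scattered (X i)")
    case True
    then show ?thesis using scat ramsey_family_infinite_sets by blast
  next
    case False
    then obtain i where i: "i \<in> I" "\<not> scattered (X i)" by blast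
    have "infinite (X i)"
    proof
      assume fin: "finite (X i)"
      obtain f :: "rat \<Rightarrow> rat" where f: "strict_mono_on UNIV f" "range f \<subseteq> X i"
        using not_scattered_universal[OF i(2), of UNIV] unfolding embeds_def by blast
      have "finite (range f)" using finite_subset[OF f(2) fin] .
      then show False
        using finite_imageD[OF _ strict_mono_on_imp_inj_on[OF f(1)]] infinite_UNIV_char_0 by blast
    qed
    then have fam: "ramsey_family (copies (X i))" using ramsey_family_copies assms i(1) by blast
    moreover have "coded (copies (X i)) (X j)" if "j \<in> I" for j
    proof (cases "scattered (X j)")
      case True
      then show ?thesis using scat[OF fam that] by blast
    next
      case False
      then have "X i \<simeq> X j"
        using not_scattered_universal i(2) unfolding equimorphic_def by blast
      then show ?thesis using coded_equimorphic[OF coded_copies] by blast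
    qed
    ultimately show ?thesis by blast
  qed
qed

section \<open>Passing between chains and sets of rationals\<close>

definition realizes :: "('a \<Rightarrow> rat) \<Rightarrow> 'a rel \<Rightarrow> bool" where
  "realizes \<phi> C \<longleftrightarrow> (\<forall>x\<in>Field C. \<forall>y\<in>Field C. \<phi> x < \<phi> y \<longleftrightarrow> (x, y) \<in> C \<and> x \<noteq> y)"

lemma realizes_exists:
  assumes "Linear_order C" "countable (Field C)"
  shows "\<exists>\<phi>. realizes \<phi> C"
proof -
  have lin: "total_on (Field C) C" "trans C" "antisym C"
    using assms(1) unfolding linear_order_on_def partial_order_on_def preorder_on_def by blast+
  have "\<exists>f. (\<forall>x\<in>Field C. (0::rat) < f x) \<and> (\<forall>x\<in>Field C. \<forall>y\<in>Field C. (x, y) \<in> C \<and> x \<noteq> y \<longrightarrow> f x < f y)"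
  proof (rule countable_chain_into_dense[of "(<)" 0 1, OF _ _ _ assms(2)])
    show "\<exists>c. a < c \<and> c < b" if "a < b" for a b :: rat using that by (rule dense)
    show "(x, z) \<in> C \<and> x \<noteq> z" if "(x, y) \<in> C \<and> x \<noteq> y" "(y, z) \<in> C \<and> y \<noteq> z" for x y z
      using that lin(2,3) by (meson antisymD transD)
    show "(x, y) \<in> C \<and> x \<noteq> y \<or> (y, x) \<in> C \<and> y \<noteq> x" if "x \<in> Field C" "y \<in> Field C" "x \<noteq> y" for x y
      using that lin(1) unfolding total_on_def by blast
  qed auto
  then obtain f :: "'a \<Rightarrow> rat" where
    f: "\<And>x y. x \<in> Field C \<Longrightarrow> y \<in> Field C \<Longrightarrow> (x, y) \<in> C \<Longrightarrow> x \<noteq> y \<Longrightarrow> f x < f y" by blast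
  have "(x, y) \<in> C \<and> x \<noteq> y" if "x \<in> Field C" "y \<in> Field C" "f x < f y" for x y
  proof -
    have "x \<noteq> y" using that(3) by blast
    moreover have "(y, x) \<notin> C" using f[OF that(2,1)] that(3) \<open>x \<noteq> y\<close> by fastforce
    ultimately show ?thesis using lin(1) that(1,2) unfolding total_on_def by blast
  qed
  then show ?thesis unfolding realizes_def using f by blast
qed

lemma realizes_inj_on:
  assumes "realizes \<phi> C" "Linear_order C"
  shows "inj_on \<phi> (Field C)"
proof (rule inj_onI)
  fix x y assume xy: "x \<in> Field C" "y \<in> Field C" "\<phi> x = \<phi> y"
  have "total_on (Field C) C" using assms(2) unfolding linear_order_on_def by blast
  then show "x = y" using xy assms(1) unfolding realizes_def total_on_def by (metis less_irrefl)
qed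

lemma Field_natLeq_on_lessThan: "Field (natLeq_on n) = {..<n}"
  by (auto simp: Field_natLeq_on)

lemma realizes_Emb:
  assumes \<phi>: "realizes \<phi> C" "Linear_order C" and v: "strict_mono_on (\<phi> ` Field C) v" "v ` \<phi> ` Field C \<subseteq> \<phi> ` Field C"
  obtains w where "w \<in> Emb C C" "\<And>x. x \<in> Field C \<Longrightarrow> w x \<in> Field C \<and> \<phi> (w x) = v (\<phi> x)"
proof
  let ?w = "restrict (\<lambda>x. inv_into (Field C) \<phi> (v (\<phi> x))) (Field C)"
  show w: "?w x \<in> Field C \<and> \<phi> (?w x) = v (\<phi> x)" if "x \<in> Field C" for x
  proof -
    have "v (\<phi> x) \<in> \<phi> ` Field C" using v(2) that by blast
    then show ?thesis using that by (simp add: inv_into_into f_inv_into_f)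
  qed
  show "?w \<in> Emb C C"
    unfolding Emb_def mem_Collect_eq
  proof (intro conjI allI impI)
    show "?w \<in> Field C \<rightarrow>\<^sub>E Field C" using w by (intro PiE_I) auto
    fix x y assume xy: "(x, y) \<in> C \<and> x \<noteq> y"
    then have F: "x \<in> Field C" "y \<in> Field C" by (auto intro: FieldI1 FieldI2)
    then have "\<phi> x < \<phi> y" using \<phi>(1) xy unfolding realizes_def by blast
    then have "v (\<phi> x) < v (\<phi> y)" using strict_mono_onD[OF v(1)] F by blast
    then have "\<phi> (?w x) < \<phi> (?w y)" using w F by simp
    then have "(?w x, ?w y) \<in> C \<and> ?w x \<noteq> ?w y" using \<phi>(1) w F unfolding realizes_def by blast
    then show "(?w x, ?w y) \<in> C" "?w x \<noteq> ?w y" by blast+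
  qed
qed

lemma compose_Emb:
  assumes "w \<in> Emb B C" "f \<in> Emb A B"
  shows "compose (Field A) w f \<in> Emb A C"
proof -
  have w: "w \<in> Field B \<rightarrow>\<^sub>E Field C" "\<And>x y. (x, y) \<in> B \<Longrightarrow> x \<noteq> y \<Longrightarrow> (w x, w y) \<in> C \<and> w x \<noteq> w y"
    using assms(1) unfolding Emb_def by blast+
  have f: "f \<in> Field A \<rightarrow>\<^sub>E Field B" "\<And>x y. (x, y) \<in> A \<Longrightarrow> x \<noteq> y \<Longrightarrow> (f x, f y) \<in> B \<and> f x \<noteq> f y"
    using assms(2) unfolding Emb_def by blast+
  show ?thesis
    unfolding Emb_def mem_Collect_eq
  proof (intro conjI allI impI)
    show "compose (Field A) w f \<in> Field A \<rightarrow>\<^sub>E Field C"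
      using w(1) f(1) by (intro PiE_I) (auto simp: compose_def PiE_iff)
    fix x y assume xy: "(x, y) \<in> A \<and> x \<noteq> y"
    then have "x \<in> Field A" "y \<in> Field A" by (auto intro: FieldI1 FieldI2)
    then show "(compose (Field A) w f x, compose (Field A) w f y) \<in> C"
      "compose (Field A) w f x \<noteq> compose (Field A) w f y"
      using w(2) f(2) xy by (simp_all add: compose_eq)
  qed
qed

lemma Emb_from_set:
  assumes \<phi>: "realizes \<phi> C" "Linear_order C" and T: "T \<subseteq> \<phi> ` Field C" "finite T" "card T = n"
  obtains f where "f \<in> Emb (natLeq_on n) C" "\<phi> ` f ` {..<n} = T"
proof
  let ?l = "sorted_list_of_set T"
  let ?f = "restrict (\<lambda>i. inv_into (Field C) \<phi> (?l ! i)) {..<n}"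
  have len: "length ?l = n" using T(3) by simp
  have T': "?l ! i \<in> T" if "i < n" for i using nth_mem[of i ?l] that len T(2) by simp
  have f: "?f i \<in> Field C" "\<phi> (?f i) = ?l ! i" if "i < n" for i
  proof -
    have "?l ! i \<in> \<phi> ` Field C" using T' T(1) that by blast
    then show "?f i \<in> Field C" "\<phi> (?f i) = ?l ! i" using that by (simp_all add: inv_into_into f_inv_into_f)
  qed
  have "\<phi> ` ?f ` {..<n} = (\<lambda>i. ?l ! i) ` {..<n}"
    unfolding image_image using f(2) by (intro image_cong) auto
  also have "\<dots> = T" using set_conv_nth[of ?l] len T(2) by (auto simp: image_def)
  finally show "\<phi> ` ?f ` {..<n} = T" .
  show "?f \<in> Emb (natLeq_on n) C"
    unfolding Emb_def Field_natLeq_on_lessThan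
  proof (rule CollectI, intro conjI allI impI)
    show "?f \<in> {..<n} \<rightarrow>\<^sub>E Field C" using f(1) by (intro PiE_I) auto
    fix i j assume "(i, j) \<in> natLeq_on n \<and> i \<noteq> j"
    then have ij: "i < j" "i < n" "j < n" by auto
    then have "?l ! i < ?l ! j"
      using sorted_wrt_nth_less[OF strict_sorted_list_of_set, of i j T] len by simp
    then have "\<phi> (?f i) < \<phi> (?f j)" using f(2) ij by simp
    then have "(?f i, ?f j) \<in> C \<and> ?f i \<noteq> ?f j"
      using \<phi>(1) f(1)[OF ij(2)] f(1)[OF ij(3)] unfolding realizes_def by blast
    then show "(?f i, ?f j) \<in> C" "?f i \<noteq> ?f j" by blast+
  qed
qed

text \<open>A colouring of sets colours embeddings through their images. Every
  \<open>n\<close>-subset of the copy is the image of some \<open>w \<circ> f\<close>, found by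
  listing its preimage in increasing order, so it shows no further colour.\<close>

lemma finite_degrees_realization:
  assumes \<phi>: "realizes \<phi> C" "Linear_order C" and C: "finite_big_Ramsey_spectrum C"
  shows "finite_degrees (\<phi> ` Field C)"
  unfolding finite_degrees_def
proof (intro allI impI)
  let ?X = "\<phi> ` Field C"
  fix n :: nat assume "n \<ge> 1"
  then have "big_Ramsey_degree n C < \<infinity>" using C unfolding finite_big_Ramsey_spectrum_def by blast
  then obtain t where t: "big_Ramsey_bound n C t"
    unfolding big_Ramsey_degree_def by (auto split: if_splits)
  show "\<exists>t. \<forall>\<chi>::rat set \<Rightarrow> nat. finite (range \<chi>) \<longrightarrow>
    (\<exists>w. strict_mono_on ?X w \<and> w ` ?X \<subseteq> ?X \<and> card (\<chi> ` {S. S \<subseteq> w ` ?X \<and> card S = n}) \<le> t)"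
  proof (intro exI[of _ t] allI impI)
    fix \<chi> :: "rat set \<Rightarrow> nat" assume fin: "finite (range \<chi>)"
    obtain k where k: "\<And>S. \<chi> S < k"
      using fin unfolding finite_nat_set_iff_bounded by blast
    let ?\<chi> = "\<lambda>f. \<chi> (\<phi> ` f ` {..<n})"
    have "k \<ge> 1" using k[of "{}"] by linarith
    moreover have "?\<chi> \<in> Emb (natLeq_on n) C \<rightarrow> {..<k}" using k by simp
    ultimately obtain w where w: "w \<in> Emb C C" "card (?\<chi> ` comp_Emb w (natLeq_on n) C) \<le> t"
      using t unfolding big_Ramsey_bound_def by blast
    have wF: "w x \<in> Field C" if "x \<in> Field C" for x
      using w(1) that unfolding Emb_def by (auto simp: PiE_iff)
    \<comment> \<open>The conjugate of \<open>w\<close> under \<open>\<phi>\<close>.\<close>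
    define w' where "w' q = \<phi> (w (inv_into (Field C) \<phi> q))" for q
    have w': "w' (\<phi> x) = \<phi> (w x)" if "x \<in> Field C" for x
      unfolding w'_def using that realizes_inj_on[OF \<phi>] by simp
    have mono: "strict_mono_on ?X w'"
    proof (rule strict_mono_onI)
      fix p q assume "p \<in> ?X" "q \<in> ?X" "p < q"
      then obtain x y where xy: "x \<in> Field C" "y \<in> Field C" "p = \<phi> x" "q = \<phi> y" by blast
      then have "(x, y) \<in> C \<and> x \<noteq> y" using \<phi>(1) \<open>p < q\<close> unfolding realizes_def by blast
      then have "(w x, w y) \<in> C \<and> w x \<noteq> w y" using w(1) unfolding Emb_def by blast
      then have "\<phi> (w x) < \<phi> (w y)" using \<phi>(1) wF xy(1,2) unfolding realizes_def by blast
      then show "w' p < w' q" using w' xy by simp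
    qed
    have sub: "w' ` ?X \<subseteq> ?X" using w' wF by auto
    have le: "\<chi> ` {S. S \<subseteq> w' ` ?X \<and> card S = n} \<subseteq> ?\<chi> ` comp_Emb w (natLeq_on n) C"
    proof
      fix z assume "z \<in> \<chi> ` {S. S \<subseteq> w' ` ?X \<and> card S = n}"
      then obtain S where S: "S \<subseteq> w' ` ?X" "card S = n" "z = \<chi> S" by blast
      obtain T where T: "T \<subseteq> ?X" "S = w' ` T" using subset_imageE[OF S(1)] by metis
      have "inj_on w' T"
        using inj_on_subset[OF strict_mono_on_imp_inj_on[OF mono] T(1)] .
      then have cT: "card T = n" using S(2) T(2) by (simp add: card_image)
      then have "finite T" using \<open>n \<ge> 1\<close> card_gt_0_iff[of T] by linarith
      then obtain f where f: "f \<in> Emb (natLeq_on n) C" "\<phi> ` f ` {..<n} = T"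
        using Emb_from_set[OF \<phi> T(1) _ cT] by blast
      have fF: "f i \<in> Field C" if "i < n" for i
        using f(1) that unfolding Emb_def Field_natLeq_on_lessThan by (auto simp: PiE_iff)
      have "\<phi> ` compose {..<n} w f ` {..<n} = w' ` \<phi> ` f ` {..<n}"
        unfolding image_image by (intro image_cong) (use fF w' in \<open>auto simp: compose_eq\<close>)
      then have "?\<chi> (compose {..<n} w f) = z" using f(2) T(2) S(3) by simp
      moreover have "compose {..<n} w f \<in> comp_Emb w (natLeq_on n) C"
        unfolding comp_Emb_def Field_natLeq_on_lessThan using f(1) by (rule imageI)
      ultimately show "z \<in> ?\<chi> ` comp_Emb w (natLeq_on n) C" by blast
    qed
    have "finite (?\<chi> ` comp_Emb w (natLeq_on n) C)"
      by (rule finite_subset[OF _ fin]) auto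
    from order_trans[OF card_mono[OF this le] w(2)]
    have "card (\<chi> ` {S. S \<subseteq> w' ` ?X \<and> card S = n}) \<le> t" .
    then show "\<exists>w. strict_mono_on ?X w \<and> w ` ?X \<subseteq> ?X \<and> card (\<chi> ` {S. S \<subseteq> w ` ?X \<and> card S = n}) \<le> t"
      using mono sub by blast
  qed
qed

text \<open>Since \<open>\<phi>\<close> is injective, an embedding is determined by the rationals
  assigned to its \<open>n\<close> arguments, each of which lies in \<open>Q\<close>.\<close>

lemma card_Emb_into:
  assumes \<phi>: "realizes \<phi> C" "Linear_order C" and Q: "finite Q" "card Q \<le> b"
  shows "finite {f \<in> Emb (natLeq_on n) C. \<forall>j<n. \<phi> (f j) \<in> Q} \<and>
    card {f \<in> Emb (natLeq_on n) C. \<forall>j<n. \<phi> (f j) \<in> Q} \<le> b ^ n"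
proof -
  let ?E = "{f \<in> Emb (natLeq_on n) C. \<forall>j<n. \<phi> (f j) \<in> Q}"
  let ?h = "\<lambda>f. restrict (\<phi> \<circ> f) {..<n}"
  have inj: "inj_on ?h ?E"
  proof (rule inj_onI)
    fix f g assume fg: "f \<in> ?E" "g \<in> ?E" "?h f = ?h g"
    have PE: "f \<in> {..<n} \<rightarrow>\<^sub>E Field C" "g \<in> {..<n} \<rightarrow>\<^sub>E Field C"
      using fg(1,2) unfolding Emb_def Field_natLeq_on_lessThan by blast+
    show "f = g"
    proof (rule PiE_ext[OF PE])
      fix i assume i: "i \<in> {..<n}"
      then have "\<phi> (f i) = \<phi> (g i)" using fun_cong[OF fg(3), of i] by simp
      then show "f i = g i"
        using inj_onD[OF realizes_inj_on[OF \<phi>]] PE i by (auto simp: PiE_iff)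
    qed
  qed
  have into: "?h ` ?E \<subseteq> {..<n} \<rightarrow>\<^sub>E Q"
    by (intro image_subsetI PiE_I) auto
  have fin: "finite ({..<n} \<rightarrow>\<^sub>E Q)" using Q(1) by (intro finite_PiE) auto
  have "finite ?E" using inj_on_finite[OF inj into fin] .
  moreover have "card ?E \<le> card ({..<n} \<rightarrow>\<^sub>E Q)" using card_inj_on_le[OF inj into fin] .
  moreover have "card ({..<n} \<rightarrow>\<^sub>E Q) = card Q ^ n" by (simp add: card_PiE)
  moreover have "card Q ^ n \<le> b ^ n" using Q(2) by (intro power_mono) auto
  ultimately show ?thesis by linarith
qed

text \<open>A set \<open>S\<close> of codes is coloured by the set of colours of the tuples all of whose points are
  coded in \<open>S\<close>; there are boundedly many such tuples.\<close>

theorem theorem5p18: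
  fixes r :: nat and C :: "nat \<Rightarrow> 'a rel" and n :: "nat \<Rightarrow> nat"
  assumes "\<And>i. i \<in> {1..r} \<Longrightarrow> Linear_order (C i)"
    and "\<And>i. i \<in> {1..r} \<Longrightarrow> countable (Field (C i))"
    and "\<And>i. i \<in> {1..r} \<Longrightarrow> finite_big_Ramsey_spectrum (C i)"
    and "\<And>i. i \<in> {1..r} \<Longrightarrow> n i \<ge> 1"
  shows "\<exists>N::nat. N \<ge> 1 \<and>
    (\<forall>k\<ge>1. \<forall>\<gamma> \<in> (\<Pi>\<^sub>E i\<in>{1..r}. Emb (natLeq_on (n i)) (C i)) \<rightarrow> {..<k::nat}.
       \<exists>w. (\<forall>i\<in>{1..r}. w i \<in> Emb (C i) (C i)) \<and>
         card (\<gamma> ` (\<Pi>\<^sub>E i\<in>{1..r}. comp_Emb (w i) (natLeq_on (n i)) (C i))) \<le> N)"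
proof -
  let ?I = "{1..r}"
  have "\<exists>\<phi>. realizes \<phi> (C i)" if "i \<in> ?I" for i using realizes_exists assms(1,2) that by blast
  then obtain \<phi> where \<phi>: "\<And>i. i \<in> ?I \<Longrightarrow> realizes (\<phi> i) (C i)" by metis
  let ?X = "\<lambda>i. \<phi> i ` Field (C i)"
  have "finite_degrees (?X i)" if "i \<in> ?I" for i
    using finite_degrees_realization[OF \<phi>[OF that] assms(1)[OF that] assms(3)[OF that]] .
  then obtain \<M> where \<M>: "ramsey_family \<M>" "\<forall>i\<in>?I. coded \<M> (?X i)"
    using common_ramsey_family[of ?I ?X] by blast
  obtain p d B where c: "\<And>i. i \<in> ?I \<Longrightarrow> coding \<M> (?X i) (p i) (d i) (B i)"
    using \<M>(2) unfolding coded_def by metis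
  \<comment> \<open>A tuple has \<open>n i\<close> points in coordinate \<open>i\<close>, each with
    a code of size at most \<open>d i\<close>. The successor ensures \<open>m \<ge> 1\<close>, as
    \<open>ramsey_family\<close> demands.\<close>
  define m where "m = Suc (\<Sum>i\<in>?I. n i * d i)"
  obtain t where t: "\<And>\<chi>::nat set \<Rightarrow> nat. finite (range \<chi>) \<Longrightarrow>
      \<exists>M\<in>\<M>. card (\<chi> ` {S. S \<subseteq> M \<and> card S = m}) \<le> t"
    using \<M>(1) unfolding ramsey_family_def m_def by (metis le_numeral_extra(4) One_nat_def Suc_le_mono le0)
  \<comment> \<open>A set of \<open>m\<close> naturals codes at most \<open>B i m\<close> points in
    coordinate \<open>i\<close>, hence at most this many tuples.\<close>
  define K where "K = (\<Prod>i\<in>?I. B i m ^ n i)"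
  \<comment> \<open>On \<open>M\<close> there remain at most \<open>t\<close> sets of colours, each
    with at most \<open>K\<close> elements; the successor secures \<open>N \<ge> 1\<close>.\<close>
  show ?thesis
  proof (intro exI[of _ "Suc (t * K)"] conjI allI impI ballI)
    fix k :: nat and \<gamma>
    assume \<gamma>: "\<gamma> \<in> (\<Pi>\<^sub>E i\<in>?I. Emb (natLeq_on (n i)) (C i)) \<rightarrow> {..<k}"
    define E where "E S i = {f \<in> Emb (natLeq_on (n i)) (C i). \<forall>j<n i. \<phi> i (f j) \<in> p i S}" for S i
    define G where "G S = Pi\<^sub>E ?I (E S)" for S
    have sub: "\<gamma> ` G S \<subseteq> {..<k}" for S
    proof -
      have "G S \<subseteq> (\<Pi>\<^sub>E i\<in>?I. Emb (natLeq_on (n i)) (C i))"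
        unfolding G_def by (intro PiE_mono) (auto simp: E_def)
      then show ?thesis using \<gamma> by blast
    qed
    have small: "card (\<gamma> ` G S) \<le> K" if S: "card S = m" for S
    proof -
      have "finite S" using S card_gt_0_iff[of S] unfolding m_def by linarith
      have E: "finite (E S i) \<and> card (E S i) \<le> B i m ^ n i" if "i \<in> ?I" for i
        unfolding E_def S[symmetric]
        by (rule card_Emb_into[OF \<phi>[OF that] assms(1)[OF that]
            codingD(1,2)[OF c[OF that] \<open>finite S\<close>]])
      have "finite (G S)" unfolding G_def using E by (intro finite_PiE) auto
      then have "card (\<gamma> ` G S) \<le> card (G S)" by (rule card_image_le)
      also have "\<dots> = (\<Prod>i\<in>?I. card (E S i))" unfolding G_def by (rule card_PiE) simp
      also have "\<dots> \<le> K" unfolding K_def using E by (intro prod_mono) auto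
      finally show ?thesis .
    qed
    \<comment> \<open>The set of \<open>\<gamma>\<close>-colours is packed into one natural number.
      Only subsets of \<open>{..<k}\<close> occur, so the range is finite, although \<open>t\<close>
      and \<open>K\<close> do not depend on \<open>k\<close>.\<close>
    define \<chi> where "\<chi> S = set_encode (\<gamma> ` G S)" for S
    have decode: "set_decode (\<chi> S) = \<gamma> ` G S" for S
      unfolding \<chi>_def using finite_subset[OF sub] by (simp add: set_encode_inverse)
    have "range \<chi> \<subseteq> set_encode ` Pow {..<k}" unfolding \<chi>_def using sub by blast
    then have fin: "finite (range \<chi>)" by (rule finite_subset) simp
    obtain M where M: "M \<in> \<M>" "card (\<chi> ` {S. S \<subseteq> M \<and> card S = m}) \<le> t" using t[OF fin] by blast
    have infM: "infinite M" using M(1) \<M>(1) unfolding ramsey_family_def by blast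
    have "\<exists>w. w \<in> Emb (C i) (C i) \<and>
      (\<forall>x\<in>Field (C i). w x \<in> Field (C i) \<and> \<phi> i (w x) \<in> coded_points (p i) (d i) M)" if i: "i \<in> ?I" for i
    proof -
      obtain v where v: "strict_mono_on (?X i) v" "v ` ?X i \<subseteq> ?X i \<inter> coded_points (p i) (d i) M"
        using codingD(4)[OF c[OF i] M(1)] unfolding embeds_def by blast
      obtain w where w: "w \<in> Emb (C i) (C i)"
        "\<And>x. x \<in> Field (C i) \<Longrightarrow> w x \<in> Field (C i) \<and> \<phi> i (w x) = v (\<phi> i x)"
        using realizes_Emb[OF \<phi>[OF i] assms(1)[OF i] v(1)] v(2) by blast
      have "\<phi> i (w x) \<in> coded_points (p i) (d i) M" if "x \<in> Field (C i)" for x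
        using w(2)[OF that] v(2) that by auto
      then show ?thesis using w by blast
    qed
    then obtain w where w: "\<And>i. i \<in> ?I \<Longrightarrow> w i \<in> Emb (C i) (C i)"
      "\<And>i x. i \<in> ?I \<Longrightarrow> x \<in> Field (C i) \<Longrightarrow> \<phi> i (w i x) \<in> coded_points (p i) (d i) M" by metis
    let ?P = "\<Pi>\<^sub>E i\<in>?I. comp_Emb (w i) (natLeq_on (n i)) (C i)"
    have cover: "\<gamma> ` ?P \<subseteq> (\<Union>z\<in>\<chi> ` {S. S \<subseteq> M \<and> card S = m}. set_decode z)"
    proof
      fix z assume "z \<in> \<gamma> ` ?P"
      then obtain g where g: "g \<in> ?P" "z = \<gamma> g" by blast
      have gi: "g i \<in> Emb (natLeq_on (n i)) (C i) \<and>
        (\<forall>j<n i. \<phi> i (g i j) \<in> coded_points (p i) (d i) M)" if i: "i \<in> ?I" for i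
      proof -
        have "g i \<in> comp_Emb (w i) (natLeq_on (n i)) (C i)" using g(1) i by (rule PiE_mem)
        then obtain f where f: "f \<in> Emb (natLeq_on (n i)) (C i)" "g i = compose {..<n i} (w i) f"
          unfolding comp_Emb_def Field_natLeq_on_lessThan by blast
        have "f j \<in> Field (C i)" if "j < n i" for j
          using f(1) that unfolding Emb_def Field_natLeq_on_lessThan by (auto simp: PiE_iff)
        then show ?thesis
          using compose_Emb[OF w(1)[OF i] f(1)] w(2)[OF i] unfolding f(2) Field_natLeq_on_lessThan
          by (simp add: compose_eq)
      qed
      have "\<forall>i\<in>?I. \<forall>j<n i. \<exists>S. \<phi> i (g i j) \<in> p i S \<and> finite S \<and> S \<subseteq> M \<and> card S \<le> d i"
        using gi unfolding coded_points_def by blast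
      then obtain s where s: "\<And>i j. i \<in> ?I \<Longrightarrow> j < n i \<Longrightarrow>
        \<phi> i (g i j) \<in> p i (s i j) \<and> finite (s i j) \<and> s i j \<subseteq> M \<and> card (s i j) \<le> d i" by metis
      define S\<^sub>0 where "S\<^sub>0 = (\<Union>i\<in>?I. \<Union>j\<in>{..<n i}. s i j)"
      have S\<^sub>0: "finite S\<^sub>0" "S\<^sub>0 \<subseteq> M" unfolding S\<^sub>0_def using s by (simp, blast)
      have "card S\<^sub>0 \<le> (\<Sum>i\<in>?I. card (\<Union>j\<in>{..<n i}. s i j))"
        unfolding S\<^sub>0_def by (rule card_UN_le) simp
      also have "\<dots> \<le> (\<Sum>i\<in>?I. n i * d i)"
      proof (rule sum_mono)
        fix i assume i: "i \<in> ?I"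
        have "card (\<Union>j\<in>{..<n i}. s i j) \<le> (\<Sum>j<n i. card (s i j))" by (rule card_UN_le) simp
        also have "\<dots> \<le> (\<Sum>j<n i. d i)" using s[OF i] by (intro sum_mono) auto
        finally show "card (\<Union>j\<in>{..<n i}. s i j) \<le> n i * d i" by simp
      qed
      finally have "card S\<^sub>0 \<le> m" unfolding m_def by simp
      \<comment> \<open>As \<open>M\<close> is infinite, the merged codes can be filled up to
        exactly \<open>m\<close> elements; monotonicity of \<open>p i\<close> keeps all points of
        the tuple coded.\<close>
      obtain T where T: "finite T" "card T = m - card S\<^sub>0" "T \<subseteq> M - S\<^sub>0"
        using infinite_arbitrarily_large[OF Diff_infinite_finite[OF S\<^sub>0(1) infM]] by blast
      have "S\<^sub>0 \<inter> T = {}" using T(3) by blast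
      then have S: "card (S\<^sub>0 \<union> T) = m" "S\<^sub>0 \<union> T \<subseteq> M"
        using T S\<^sub>0 \<open>card S\<^sub>0 \<le> m\<close> by (auto simp: card_Un_disjoint)
      have "g \<in> G (S\<^sub>0 \<union> T)"
        unfolding G_def
      proof (rule PiE_I)
        fix i assume i: "i \<in> ?I"
        have "\<phi> i (g i j) \<in> p i (S\<^sub>0 \<union> T)" if j: "j < n i" for j
        proof -
          have "s i j \<subseteq> S\<^sub>0 \<union> T" unfolding S\<^sub>0_def using i j by blast
          then show ?thesis using codingD(3)[OF c[OF i]] s[OF i j] by blast
        qed
        then show "g i \<in> E (S\<^sub>0 \<union> T) i" unfolding E_def using gi[OF i] by blast
      next
        show "g i = undefined" if "i \<notin> ?I" for i using g(1) that by (rule PiE_arb)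
      qed
      then have "z \<in> set_decode (\<chi> (S\<^sub>0 \<union> T))" unfolding decode using g(2) by blast
      then show "z \<in> (\<Union>z\<in>\<chi> ` {S. S \<subseteq> M \<and> card S = m}. set_decode z)" using S by blast
    qed
    have finC: "finite (\<chi> ` {S. S \<subseteq> M \<and> card S = m})" by (rule finite_subset[OF _ fin]) auto
    have "card (\<gamma> ` ?P) \<le> card (\<Union>z\<in>\<chi> ` {S. S \<subseteq> M \<and> card S = m}. set_decode z)"
      by (intro card_mono[OF _ cover] finite_UN_I finC finite_set_decode)
    also have "\<dots> \<le> (\<Sum>z\<in>\<chi> ` {S. S \<subseteq> M \<and> card S = m}. card (set_decode z))"
      by (rule card_UN_le[OF finC])
    also have "\<dots> \<le> (\<Sum>z\<in>\<chi> ` {S. S \<subseteq> M \<and> card S = m}. K)"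
      using small by (intro sum_mono) (auto simp: decode)
    also have "\<dots> \<le> t * K" using M(2) by simp
    finally have "card (\<gamma> ` ?P) \<le> Suc (t * K)" by simp
    then show "\<exists>w. (\<forall>i\<in>?I. w i \<in> Emb (C i) (C i)) \<and>
        card (\<gamma> ` (\<Pi>\<^sub>E i\<in>?I. comp_Emb (w i) (natLeq_on (n i)) (C i))) \<le> Suc (t * K)"
      using w(1) by blast
  qed simp
qed

end
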